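(* Let $n\ge 2$ and let $\alpha_1,\dots,\alpha_n$ be real numbers in $]-1,\infty[$ with $\sum_{i=1}^n\alpha_i=0$. Let $\tau\in\mathbb H$ and let $z=(z_1,\dots,z_n)\in\mathbb C^n$ be such that the classes $[z_1],\dots,[z_n]$ are pairwise distinct in $E_\tau=\mathbb C/(\mathbb Z\oplus\mathbb Z\tau)$. Let $m^\alpha_{\tau,z}$ be the flat metric on $E_\tau$, unique up to multiplication by a positive constant, compatible with the conformal structure of $E_\tau$ and having a conical singularity of type $|u^{\alpha_i}du|^2$ (cone angle $2\pi(1+\alpha_i)$) at $[z_i]$ for $i=1,\dots,n$. Then, up to multiplication by a positive constant, $$m^\alpha_{\tau,z}=\big|T^\alpha_{\tau,z}(u)\,du\big|^2,$$ where $T^\alpha_{\tau,z}$ is the multivalued holomorphic function on $E_\tau\setminus\{[z_1],\dots,[z_n]\}$ given by $$T^\alpha_{\tau,z}(u)=\exp(2i\pi a_0u)\prod_{i=1}^n\theta(u-z_i,\tau)^{\alpha_i},\qquad a_0=a_0(\tau,z)=-\frac{\operatorname{Im}\big(\sum_{i=1}^n\alpha_iz_i\big)}{\operatorname{Im}(\tau)}.$$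
   Context: $\mathbb H$ is the upper half-plane and $\theta$ is Jacobi's theta function $\theta(u,\tau)=-i\sum_{k\in\mathbb Z}(-1)^k\exp\big(i\pi(k+\tfrac12)^2\tau+2i\pi(k+\tfrac12)u\big)$. The existence and uniqueness up to scaling of the flat metric is a theorem of Troyanov. *)

theory Defs
  imports "HOL-Complex_Analysis.Complex_Analysis"
begin

definition theta :: "complex \<Rightarrow> complex \<Rightarrow> complex" where
  "theta u \<tau> = - \<i> * infsum (\<lambda>k::int. (-1) powi k *
     exp (\<i> * pi * (of_int k + 1/2)\<^sup>2 * \<tau> + 2 * \<i> * pi * (of_int k + 1/2) * u)) UNIV"

text \<open>Points of \<open>E\<^sub>\<tau> = \<complex> / (\<int> \<oplus> \<int>\<tau>)\<close> are cosets of the lattice.\<close>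

definition lattice :: "complex \<Rightarrow> complex set" where
  "lattice \<tau> = {of_int a + of_int b * \<tau> | a b. True}"

definition torus_point :: "complex \<Rightarrow> complex \<Rightarrow> complex set" where
  "torus_point \<tau> u = (\<lambda>l. u + l) ` lattice \<tau>"

text \<open>The preimage in \<open>\<complex>\<close> of \<open>E\<^sub>\<tau>\<close> minus the points \<open>[z\<^sub>1], \<dots>, [z\<^sub>n]\<close>.\<close>

definition punctured :: "complex \<Rightarrow> nat \<Rightarrow> (nat \<Rightarrow> complex) \<Rightarrow> complex set" where
  "punctured \<tau> n z = {u. torus_point \<tau> u \<notin> (\<lambda>i. torus_point \<tau> (z i)) ` {1..n}}"

text \<open>
  A metric on a part of the \<open>u\<close>-plane is given by its first fundamental form: \<open>g u v w\<close> is the inner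
  product at the point \<open>u\<close> of the tangent vectors \<open>v\<close> and \<open>w\<close>, where the real tangent space at \<open>u\<close>
  is identified with \<open>\<complex>\<close>. Since \<open>\<complex> \<rightarrow> E\<^sub>\<tau>\<close> is a local biholomorphism and translations act trivially
  on tangent vectors, metrics on \<open>E\<^sub>\<tau>\<close> correspond to lattice-invariant metrics on the plane.
\<close>

type_synonym metric_form = "complex \<Rightarrow> complex \<Rightarrow> complex \<Rightarrow> real"

text \<open>The value \<open>|t du|\<^sup>2\<close> at one point, as an inner product on the tangent space.\<close>

definition abs_sq_form :: "complex \<Rightarrow> complex \<Rightarrow> complex \<Rightarrow> real" where
  "abs_sq_form t v w = (t * v) \<bullet> (t * w)"

definition lattice_invariant_on :: "complex set \<Rightarrow> complex \<Rightarrow> metric_form \<Rightarrow> bool" where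
  "lattice_invariant_on S \<tau> g \<longleftrightarrow> (\<forall>u\<in>S. \<forall>l\<in>lattice \<tau>. g (u + l) = g u)"

definition conformal_on :: "complex set \<Rightarrow> metric_form \<Rightarrow> bool" where
  "conformal_on S g \<longleftrightarrow> (\<forall>u\<in>S. \<exists>r>0. \<forall>v w. g u v w = r * (v \<bullet> w))"

text \<open>
  Flatness: every point has a neighbourhood with a \<open>C\<^sup>1\<close> isometry \<open>\<phi>\<close> onto a piece of the Euclidean
  plane. The map \<open>\<phi>\<close> is only required to be real differentiable, and may reverse orientation; for a
  conformal \<open>g\<close> such a \<open>\<phi>\<close> is locally holomorphic or antiholomorphic, so \<open>g\<close> is automatically smooth.
\<close>

definition flat_on :: "complex set \<Rightarrow> metric_form \<Rightarrow> bool" where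
  "flat_on S g \<longleftrightarrow> (\<forall>p\<in>S. \<exists>U (\<phi> :: complex \<Rightarrow> complex) \<phi>'.
     open U \<and> p \<in> U \<and> U \<subseteq> S \<and> inj_on \<phi> U \<and>
     (\<forall>u\<in>U. (\<phi> has_derivative \<phi>' u) (at u)) \<and>
     (\<forall>v. continuous_on U (\<lambda>u. \<phi>' u v)) \<and>
     (\<forall>u\<in>U. \<forall>v w. g u v w = \<phi>' u v \<bullet> \<phi>' u w))"

text \<open>
  Conical singularity of type \<open>|x\<^sup>\<beta> dx|\<^sup>2\<close> at \<open>p\<close>: near \<open>p\<close>, the metric is the pullback of this
  model by some local holomorphic coordinate \<open>x = f u\<close> centred at \<open>p\<close>. As \<open>\<beta>\<close> is real,
  \<open>|x\<^sup>\<beta>| = |x|\<^sup>\<beta>\<close> for every determination of the power.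
\<close>

definition conical_at :: "complex \<Rightarrow> real \<Rightarrow> metric_form \<Rightarrow> bool" where
  "conical_at p \<beta> g \<longleftrightarrow> (\<exists>U f. open U \<and> p \<in> U \<and> f holomorphic_on U \<and> inj_on f U \<and> f p = 0 \<and>
     (\<forall>u \<in> U - {p}. \<forall>v w.
        g u v w = (cmod (f u) powr \<beta>)\<^sup>2 * abs_sq_form (deriv f u) v w))"

text \<open>Only the values of \<open>g\<close> over the punctured torus are relevant.\<close>

definition flat_cone_metric ::
  "complex \<Rightarrow> nat \<Rightarrow> (nat \<Rightarrow> real) \<Rightarrow> (nat \<Rightarrow> complex) \<Rightarrow> metric_form \<Rightarrow> bool" where
  "flat_cone_metric \<tau> n \<alpha> z g \<longleftrightarrow>
     lattice_invariant_on (punctured \<tau> n z) \<tau> g \<and>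
     conformal_on (punctured \<tau> n z) g \<and>
     flat_on (punctured \<tau> n z) g \<and>
     (\<forall>i\<in>{1..n}. conical_at (z i) (\<alpha> i) g)"

definition a0 :: "complex \<Rightarrow> nat \<Rightarrow> (nat \<Rightarrow> real) \<Rightarrow> (nat \<Rightarrow> complex) \<Rightarrow> real" where
  "a0 \<tau> n \<alpha> z = - Im (\<Sum>i=1..n. of_real (\<alpha> i) * z i) / Im \<tau>"

text \<open>
  \<open>T_branch \<tau> n \<alpha> z U f\<close>: the function \<open>f\<close> is a branch on the open set \<open>U\<close> of the multivalued
  function \<open>T\<close>. A branch of \<open>\<theta>(u - z\<^sub>i, \<tau>)\<close> to the power \<open>\<alpha>\<^sub>i\<close> is \<open>exp (\<alpha>\<^sub>i L\<^sub>i)\<close> for a holomorphic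
  logarithm \<open>L\<^sub>i\<close> of \<open>\<theta>(u - z\<^sub>i, \<tau>)\<close>.
\<close>

definition T_branch ::
  "complex \<Rightarrow> nat \<Rightarrow> (nat \<Rightarrow> real) \<Rightarrow> (nat \<Rightarrow> complex) \<Rightarrow>
   complex set \<Rightarrow> (complex \<Rightarrow> complex) \<Rightarrow> bool" where
  "T_branch \<tau> n \<alpha> z U f \<longleftrightarrow> open U \<and> U \<subseteq> punctured \<tau> n z \<and>
     (\<exists>L. (\<forall>i\<in>{1..n}. L i holomorphic_on U \<and> (\<forall>u\<in>U. exp (L i u) = theta (u - z i) \<tau>)) \<and>
          (\<forall>u\<in>U. f u = exp (2 * \<i> * pi * a0 \<tau> n \<alpha> z * u) *
                         (\<Prod>i=1..n. exp (of_real (\<alpha> i) * L i u))))"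

end

theory Submission
  imports Defs
begin

text \<open>
  The modulus \<open>F = |T|\<close> is single-valued, and the quasi-periodicity of \<open>\<theta>\<close>, together with
  \<open>\<Sum> \<alpha>\<^sub>i = 0\<close> and the choice of \<open>a\<^sub>0\<close>, makes it lattice-periodic. A conformal flat metric is locally
  \<open>|g du|\<^sup>2\<close> with \<open>g\<close> holomorphic, so for any flat metric \<open>m\<close> with the prescribed cone points the ratio
  \<open>\<surd>m / F\<close> is locally the modulus of a holomorphic function, at the cone points too because
  \<open>|u - z\<^sub>i|\<close> to the power \<open>\<alpha>\<^sub>i\<close> cancels. By the maximum modulus principle on the compact torus the
  ratio is constant. Conversely, near \<open>z\<^sub>i\<close> the form \<open>|T du|\<^sup>2\<close> is brought to the conical model by an
  explicit chart.

  Both directions need that \<open>\<theta>\<close> has simple zeros exactly at the lattice points. Instead of counting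
  zeros by the argument principle, \<open>|\<theta>|\<close> is compared with the modulus of the triple product, again by
  the maximum modulus principle on the torus.
\<close>

subsection \<open>Periodic functions on the plane\<close>

text \<open>The multivaluedness of T shapes the proof. Real exponents make any two branches differ
  by a locally constant factor of modulus 1, so uniqueness is argued with moduli alone: the maximum
  principle is stated for a real function that is only locally the modulus of some holomorphic
  function, and these local functions need not fit together. The same statement then applies to
  \<theta> against the product, where again only absolute values are compared. The series of
  \<theta> displays its multipliers but hides its zeros; the functional equation F(w) = (1 - w) F(q
  w) behind the product displays both. The quotient is known to have no poles only once the product
  is known to vanish simply, so simplicity is proved for the product first and then carried over to
  \<theta> through the moduli.\<close>

lemma lattice_0 [simp]: "0 \<in> lattice \<tau>"
  unfolding lattice_def by (rule CollectI, rule exI[of _ 0], rule exI[of _ 0]) simp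

lemma lattice_add: "x \<in> lattice \<tau> \<Longrightarrow> y \<in> lattice \<tau> \<Longrightarrow> x + y \<in> lattice \<tau>"
proof -
  assume "x \<in> lattice \<tau>" "y \<in> lattice \<tau>"
  then obtain a b c d :: int where
    "x = of_int a + of_int b * \<tau>" "y = of_int c + of_int d * \<tau>"
    unfolding lattice_def by blast
  then have "x + y = of_int (a + c) + of_int (b + d) * \<tau>"
    by (simp add: algebra_simps)
  then show ?thesis
    unfolding lattice_def by blast
qed

lemma lattice_minus: "x \<in> lattice \<tau> \<Longrightarrow> - x \<in> lattice \<tau>"
proof -
  assume "x \<in> lattice \<tau>"
  then obtain a b :: int where "x = of_int a + of_int b * \<tau>"
    unfolding lattice_def by blast
  then have "- x = of_int (- a) + of_int (- b) * \<tau>"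
    by (simp add: algebra_simps)
  then show ?thesis
    unfolding lattice_def by blast
qed

lemma lattice_diff: "x \<in> lattice \<tau> \<Longrightarrow> y \<in> lattice \<tau> \<Longrightarrow> x - y \<in> lattice \<tau>"
  using lattice_add[OF _ lattice_minus] by fastforce

lemma lattice_add_cancel: "l \<in> lattice \<tau> \<Longrightarrow> x + l \<in> lattice \<tau> \<longleftrightarrow> x \<in> lattice \<tau>"
  using lattice_add lattice_diff by fastforce

lemma torus_point_eq_iff: "torus_point \<tau> u = torus_point \<tau> v \<longleftrightarrow> u - v \<in> lattice \<tau>"
proof
  assume "torus_point \<tau> u = torus_point \<tau> v"
  moreover have "u \<in> torus_point \<tau> u"
    unfolding torus_point_def by (rule image_eqI[of _ _ 0]) auto
  ultimately show "u - v \<in> lattice \<tau>"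
    unfolding torus_point_def by auto
next
  assume *: "u - v \<in> lattice \<tau>"
  have "torus_point \<tau> x \<subseteq> torus_point \<tau> y" if "x - y \<in> lattice \<tau>" for x y
  proof
    fix t assume "t \<in> torus_point \<tau> x"
    then obtain l where "l \<in> lattice \<tau>" "t = x + l"
      unfolding torus_point_def by blast
    then show "t \<in> torus_point \<tau> y"
      unfolding torus_point_def
      using lattice_add[OF that, of l] by (intro image_eqI[of _ _ "x - y + l"]) auto
  qed
  from this[OF *] this[of v u] lattice_minus[OF *]
  show "torus_point \<tau> u = torus_point \<tau> v"
    by auto
qed

lemma punctured_iff: "u \<in> punctured \<tau> n z \<longleftrightarrow> (\<forall>i\<in>{1..n}. u - z i \<notin> lattice \<tau>)"
  unfolding punctured_def by (auto simp: torus_point_eq_iff)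

lemma punctured_add:
  assumes "l \<in> lattice \<tau>"
  shows "u + l \<in> punctured \<tau> n z \<longleftrightarrow> u \<in> punctured \<tau> n z"
  unfolding punctured_iff
  using lattice_add_cancel[OF assms, of "u - z i" for i] by (simp add: algebra_simps)

lemma periodic_int:
  assumes "\<And>u::complex. f (u + p) = f u"
  shows "f (u + of_int k * p) = f u"
proof (induction k rule: int_induct[of _ 0])
  case (step1 i)
  then show ?case
    using assms[of "u + of_int i * p"] by (simp add: algebra_simps)
next
  case (step2 i)
  then show ?case
    using assms[of "u + of_int (i - 1) * p"] by (simp add: algebra_simps)
qed simp

lemma lattice_periodic:
  assumes "\<And>u. f (u + 1) = f u" "\<And>u. f (u + \<tau>) = f u" "l \<in> lattice \<tau>"
  shows "f (u + l) = f u"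
proof -
  from assms(3) obtain a b :: int where l: "l = of_int a + of_int b * \<tau>"
    unfolding lattice_def by blast
  have "f (u + l) = f ((u + of_int a * 1) + of_int b * \<tau>)"
    by (simp add: l add.assoc)
  also have "\<dots> = f u"
    using periodic_int[of f 1, OF assms(1)] periodic_int[of f \<tau>, OF assms(2)] by simp
  finally show ?thesis .
qed

text \<open>Compactness of the torus: the closed parallelogram spanned by 1 and \<tau> meets every
  class.\<close>

lemma lattice_fundamental_domain:
  assumes "Im \<tau> > 0"
  obtains K where "compact K" "\<And>u. \<exists>l\<in>lattice \<tau>. u + l \<in> K"
proof
  define F where "F = (\<lambda>(s::real, t::real). of_real s + of_real t * \<tau>)"
  have "continuous_on ({0..1} \<times> {0..1}) F"
    unfolding F_def case_prod_beta by (intro continuous_intros)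
  then show "compact (F ` ({0..1} \<times> {0..1}))"
    by (intro compact_continuous_image compact_Times) auto
  fix u :: complex
  \<comment> \<open>\<open>s\<close> and \<open>t\<close> are the real coordinates of
    \<open>u\<close> in the basis 1, \<tau>; subtracting their floors lands in the
    parallelogram.\<close>
  define t where "t = Im u / Im \<tau>"
  define s where "s = Re u - t * Re \<tau>"
  have u: "u = of_real s + of_real t * \<tau>"
    using assms by (simp add: complex_eq_iff s_def t_def)
  define l where "l = of_int (- \<lfloor>s\<rfloor>) + of_int (- \<lfloor>t\<rfloor>) * \<tau>"
  have "l \<in> lattice \<tau>"
    unfolding l_def lattice_def by blast
  moreover have "u + l = F (frac s, frac t)"
    unfolding F_def l_def frac_def u by (simp add: algebra_simps)
  moreover have "frac s \<in> {0..1}" "frac t \<in> {0..1}"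
    using frac_ge_0 frac_lt_1 less_imp_le by auto
  ultimately show "\<exists>l\<in>lattice \<tau>. u + l \<in> F ` ({0..1} \<times> {0..1})"
    by (metis SigmaI imageI)
qed

text \<open>
  \<open>q\<close> continues to the whole torus, where it attains its maximum; the set of maximum points is
  closed, and open by the maximum modulus principle.
\<close>
lemma torus_locally_modulus_constant:
  fixes q :: "complex \<Rightarrow> real"
  assumes \<tau>: "Im \<tau> > 0"
    and S: "\<And>u l. u \<in> S \<Longrightarrow> l \<in> lattice \<tau> \<Longrightarrow> u + l \<in> S"
    and q: "\<And>u l. u \<in> S \<Longrightarrow> l \<in> lattice \<tau> \<Longrightarrow> q (u + l) = q u"
    and loc: "\<And>p. \<exists>l\<in>lattice \<tau>. \<exists>\<epsilon>>0. \<exists>g. g holomorphic_on ball (p + l) \<epsilon> \<and>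
      ball (p + l) \<epsilon> - {p + l} \<subseteq> S \<and> (\<forall>u\<in>ball (p + l) \<epsilon> \<inter> S. q u = cmod (g u))"
  obtains c where "\<And>u. u \<in> S \<Longrightarrow> q u = c"
proof -
  \<comment> \<open>\<open>loc\<close> lets the local function live at whichever translate of
    \<open>p\<close> is convenient, such as 0 or a cone point; periodicity of \<open>S\<close> and
    \<open>q\<close> carries it back to \<open>p\<close>.\<close>
  have loc': "\<exists>\<epsilon>>0. \<exists>g. g holomorphic_on ball p \<epsilon> \<and>
      ball p \<epsilon> - {p} \<subseteq> S \<and> (\<forall>u\<in>ball p \<epsilon> \<inter> S. q u = cmod (g u))" for p
  proof -
    from loc[of p] obtain l \<epsilon> g where l: "l \<in> lattice \<tau>" and \<epsilon>: "\<epsilon> > 0"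
      and g: "g holomorphic_on ball (p + l) \<epsilon>" and sub: "ball (p + l) \<epsilon> - {p + l} \<subseteq> S"
      and qg: "\<forall>u\<in>ball (p + l) \<epsilon> \<inter> S. q u = cmod (g u)"
      by blast
    have shift: "u + l \<in> ball (p + l) \<epsilon>" if "u \<in> ball p \<epsilon>" for u
      using that by (simp add: dist_norm)
    have "(\<lambda>u. g (u + l)) holomorphic_on ball p \<epsilon>"
      by (rule holomorphic_on_compose_gen[OF _ g, of "\<lambda>u. u + l", unfolded o_def])
        (auto intro!: holomorphic_intros shift)
    moreover have "ball p \<epsilon> - {p} \<subseteq> S"
    proof
      fix u assume u: "u \<in> ball p \<epsilon> - {p}"
      then have "u + l \<in> S"
        using sub shift by auto
      from S[OF this lattice_minus[OF l]] show "u \<in> S"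
        by simp
    qed
    moreover have "\<forall>u\<in>ball p \<epsilon> \<inter> S. q u = cmod (g (u + l))"
      using qg q S l shift by fastforce
    ultimately show ?thesis
      using \<epsilon> by blast
  qed
  \<comment> \<open>A punctured limit ignores the value at \<open>p\<close> itself, so one formula
    serves the points of \<open>S\<close> and the missing ones.\<close>
  define Q where "Q p = Lim (at p) q" for p
  have Q_loc: "\<exists>\<epsilon>>0. \<exists>g. g holomorphic_on ball p \<epsilon> \<and> ball p \<epsilon> - {p} \<subseteq> S \<and>
      (\<forall>u\<in>ball p \<epsilon> \<inter> S. q u = cmod (g u)) \<and> (\<forall>u\<in>ball p \<epsilon>. (q \<longlongrightarrow> cmod (g u)) (at u) \<and> Q u = cmod (g u))"
    for p
  proof -
    from loc'[of p] obtain \<epsilon> g where \<epsilon>: "\<epsilon> > 0" and g: "g holomorphic_on ball p \<epsilon>"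
      and sub: "ball p \<epsilon> - {p} \<subseteq> S" and qg: "\<forall>u\<in>ball p \<epsilon> \<inter> S. q u = cmod (g u)"
      by blast
    have lim: "(q \<longlongrightarrow> cmod (g u)) (at u)" if u: "u \<in> ball p \<epsilon>" for u
    proof -
      have "((\<lambda>x. cmod (g x)) \<longlongrightarrow> cmod (g u)) (at u)"
        using holomorphic_on_imp_continuous_on[OF g] u
        by (intro tendsto_norm) (auto simp: continuous_on_eq_continuous_at isCont_def)
      moreover have "\<forall>\<^sub>F x in at u. cmod (g x) = q x"
      proof -
        have "\<forall>\<^sub>F x in at u. x \<in> ball p \<epsilon>"
          using u by (intro eventually_at_in_open') auto
        moreover have "\<forall>\<^sub>F x in at u. x \<noteq> p"
          using eventually_neq_at_within by blast
        ultimately show ?thesis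
          by eventually_elim (use qg sub in auto)
      qed
      ultimately show ?thesis
        by (rule Lim_transform_eventually)
    qed
    moreover have "Q u = cmod (g u)" if "u \<in> ball p \<epsilon>" for u
      unfolding Q_def by (intro tendsto_Lim lim that) simp
    ultimately show ?thesis
      using \<epsilon> g sub qg by blast
  qed
  have Q_per: "Q (p + l) = Q p" if l: "l \<in> lattice \<tau>" for p l
  proof -
    obtain \<epsilon> g where \<epsilon>: "\<epsilon> > 0" and sub: "ball p \<epsilon> - {p} \<subseteq> S"
      and lim: "(q \<longlongrightarrow> cmod (g p)) (at p)" and Q: "Q p = cmod (g p)"
      using Q_loc[of p] by (metis centre_in_ball)
    have "((\<lambda>x. q (x + (p + l))) \<longlongrightarrow> cmod (g p)) (at 0)"
    proof (rule Lim_transform_eventually)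
      show "((\<lambda>x. q (x + p)) \<longlongrightarrow> cmod (g p)) (at 0)"
        using lim by (subst (asm) at_to_0) (simp add: filterlim_filtermap)
      have "\<forall>\<^sub>F x in at 0. x \<in> ball 0 \<epsilon> - {0::complex}"
        using \<epsilon> by (intro eventually_at_in_open) auto
      then show "\<forall>\<^sub>F x in at 0. q (x + p) = q (x + (p + l))"
      proof eventually_elim
        case (elim x)
        then have "x + p \<in> ball p \<epsilon> - {p}"
          by (auto simp: dist_norm)
        with sub have "x + p \<in> S"
          by blast
        from q[OF this l] show ?case
          by (simp add: add.assoc)
      qed
    qed
    then have "(q \<longlongrightarrow> cmod (g p)) (at (p + l))"
      by (subst at_to_0) (simp add: filterlim_filtermap)
    then show ?thesis
      unfolding Q by (simp add: Q_def tendsto_Lim)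
  qed
  have Q_cont: "continuous_on A Q" for A
  proof -
    have "isCont Q p" for p
    proof -
      obtain \<epsilon> g where "\<epsilon> > 0" and g: "g holomorphic_on ball p \<epsilon>"
        and Q: "\<forall>u\<in>ball p \<epsilon>. Q u = cmod (g u)"
        using Q_loc[of p] by blast
      have "continuous_on (ball p \<epsilon>) (\<lambda>u. cmod (g u))"
        using g by (intro continuous_intros holomorphic_on_imp_continuous_on)
      then have "continuous_on (ball p \<epsilon>) Q"
        by (rule continuous_on_eq) (use Q in auto)
      then show ?thesis
        using \<open>\<epsilon> > 0\<close> by (simp add: continuous_on_eq_continuous_at)
    qed
    then show ?thesis
      by (simp add: continuous_at_imp_continuous_on)
  qed
  obtain K where K: "compact K" "\<And>u. \<exists>l\<in>lattice \<tau>. u + l \<in> K"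
    using lattice_fundamental_domain[OF \<tau>] by blast
  then have "K \<noteq> {}"
    by blast
  from continuous_attains_sup[OF K(1) this Q_cont]
  obtain p0 where p0: "\<And>u. u \<in> K \<Longrightarrow> Q u \<le> Q p0"
    by blast
  have max: "Q u \<le> Q p0" for u
    using K(2)[of u] p0 Q_per by metis
  define A where "A = {u. Q u = Q p0}"
  have "closed A"
    unfolding A_def using closed_Collect_eq[OF Q_cont, of "\<lambda>_. Q p0"] by simp
  moreover have "open A"
    unfolding open_contains_ball
  proof
    fix p assume "p \<in> A"
    obtain \<epsilon> g where \<epsilon>: "\<epsilon> > 0" and g: "g holomorphic_on ball p \<epsilon>"
      and Q: "\<forall>u\<in>ball p \<epsilon>. Q u = cmod (g u)"
      using Q_loc[of p] by blast
    have "g constant_on ball p \<epsilon>"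
    proof (rule maximum_modulus_principle[OF g])
      fix u assume "u \<in> ball p \<epsilon>"
      then show "cmod (g u) \<le> cmod (g p)"
        using Q max \<open>p \<in> A\<close> \<epsilon> unfolding A_def by (metis (full_types) centre_in_ball mem_Collect_eq)
    qed (use \<epsilon> in auto)
    then have "\<forall>u\<in>ball p \<epsilon>. Q u = Q p"
      using Q \<epsilon> unfolding constant_on_def by auto
    moreover have "Q p = Q p0"
      using \<open>p \<in> A\<close> by (simp add: A_def)
    ultimately have "ball p \<epsilon> \<subseteq> A"
      unfolding A_def by (metis (mono_tags) mem_Collect_eq subsetI)
    then show "\<exists>e>0. ball p e \<subseteq> A"
      using \<epsilon> by blast
  qed
  ultimately have "A = UNIV"
    using clopen[of A] unfolding A_def by auto
  show thesis
  proof (rule that)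
    fix u assume "u \<in> S"
    obtain \<epsilon> g where "\<epsilon> > 0" "\<forall>v\<in>ball u \<epsilon> \<inter> S. q v = cmod (g v)" "\<forall>v\<in>ball u \<epsilon>. Q v = cmod (g v)"
      using Q_loc[of u] by blast
    then have "q u = Q u"
      using \<open>u \<in> S\<close> by simp
    then show "q u = Q p0"
      using \<open>A = UNIV\<close> unfolding A_def by auto
  qed
qed

subsection \<open>The triple product\<close>

text \<open>Ratio test with a ratio tending to 0, hence an infinite radius of convergence. It serves
  Euler's series and the half series of \<theta> alike.\<close>

lemma entire_powser_summable:
  fixes c :: "nat \<Rightarrow> complex"
  assumes r: "\<And>n. cmod (c (Suc n)) \<le> r n * cmod (c n)" "r \<longlonglongrightarrow> 0"
  shows "summable (\<lambda>n. cmod (c n * x ^ n))"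
proof -
  have "(\<lambda>n. r n * cmod x) \<longlonglongrightarrow> 0"
    using tendsto_mult_left_zero[OF r(2)] .
  then have "\<forall>\<^sub>F n in sequentially. r n * cmod x < 1/2"
    by (rule order_tendstoD) simp
  then obtain N where N: "\<And>n. n \<ge> N \<Longrightarrow> r n * cmod x < 1/2"
    unfolding eventually_sequentially by blast
  show ?thesis
  proof (rule summable_ratio_test[of "1/2" N])
    fix n assume n: "n \<ge> N"
    have "cmod (c (Suc n) * x ^ Suc n) \<le> r n * cmod (c n) * cmod x ^ Suc n"
      unfolding norm_mult norm_power by (intro mult_right_mono r) simp
    also have "\<dots> = (r n * cmod x) * cmod (c n * x ^ n)"
      by (simp add: norm_mult norm_power)
    also have "\<dots> \<le> 1/2 * cmod (c n * x ^ n)"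
      using N[OF n] by (intro mult_right_mono) auto
    finally show "norm (cmod (c (Suc n) * x ^ Suc n)) \<le> 1/2 * norm (cmod (c n * x ^ n))"
      by simp
  qed simp
qed

lemma entire_powser_holomorphic:
  fixes c :: "nat \<Rightarrow> complex"
  assumes "\<And>x. summable (\<lambda>n. c n * x ^ n)"
  shows "(\<lambda>x. \<Sum>n. c n * x ^ n) holomorphic_on A"
  unfolding holomorphic_on_def field_differentiable_def
  using termdiffs_strong_converges_everywhere[OF assms] has_field_derivative_at_within by blast

lemma exp_2pi_i_eq_1_iff: "exp (2 * \<i> * pi * x) = 1 \<longleftrightarrow> (\<exists>k::int. x = of_int k)"
proof -
  have "exp (2 * \<i> * pi * x) = 1 \<longleftrightarrow> Im x = 0 \<and> (\<exists>k::int. 2 * pi * Re x = of_int (2 * k) * pi)"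
    by (simp add: exp_eq_1)
  also have "\<dots> \<longleftrightarrow> (\<exists>k::int. x = of_int k)"
    by (auto simp: complex_eq_iff)
  finally show ?thesis .
qed

text \<open>Comparing the coefficients of \<open>w ^ Suc n\<close> in F(w) = (1 - w) F(q w) forces
  this recursion. In closed form the coefficient is (-1)^n q^(n(n-1)/2) / ((1 - q) ... (1 -
  q^n)).\<close>

primrec euler_coeff :: "complex \<Rightarrow> nat \<Rightarrow> complex" where
  "euler_coeff q 0 = 1"
| "euler_coeff q (Suc n) = - (q ^ n) / (1 - q ^ Suc n) * euler_coeff q n"

text \<open>
  The entire function \<open>(w; q)\<^sub>\<infinity> = \<Prod>\<^sub>n (1 - q\<^sup>n w)\<close>, given by Euler's power series for it. Its
  functional equation makes convergence of the product itself irrelevant.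
\<close>
definition euler_prod :: "complex \<Rightarrow> complex \<Rightarrow> complex" where
  "euler_prod q w = (\<Sum>n. euler_coeff q n * w ^ n)"

lemma one_minus_power_nz:
  assumes "cmod q < 1"
  shows "1 - q ^ Suc n \<noteq> 0"
proof
  assume "1 - q ^ Suc n = 0"
  then have "cmod q ^ Suc n = 1"
    by (metis eq_iff_diff_eq_0 norm_one norm_power)
  moreover have "cmod q ^ Suc n < 1"
    using power_strict_mono[OF assms, of "Suc n"] by simp
  ultimately show False
    by simp
qed

lemma euler_coeff_summable:
  assumes q: "cmod q < 1"
  shows "summable (\<lambda>n. euler_coeff q n * w ^ n)"
proof (rule summable_norm_cancel, rule entire_powser_summable)
  show "cmod (euler_coeff q (Suc n)) \<le> cmod q ^ n / (1 - cmod q) * cmod (euler_coeff q n)" for n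
  proof -
    \<comment> \<open>The denominators stay away from 0: |1 - q^(n+1)| \<ge> 1 - |q|^(n+1) \<ge> 1 -
      |q|.\<close>
    have "1 - cmod q \<le> 1 - cmod q ^ Suc n"
      using q power_Suc_le_self[of "cmod q" n] by (simp add: mult_left_le power_le_one)
    also have "\<dots> \<le> cmod (1 - q ^ Suc n)"
      by (metis norm_one norm_power norm_triangle_ineq2)
    finally have "cmod q ^ n / cmod (1 - q ^ Suc n) \<le> cmod q ^ n / (1 - cmod q)"
      using q by (intro divide_left_mono mult_pos_pos) auto
    from mult_right_mono[OF this norm_ge_zero[of "euler_coeff q n"]] show ?thesis
      by (simp add: norm_mult norm_divide norm_power del: power_Suc)
  qed
  show "(\<lambda>n. cmod q ^ n / (1 - cmod q)) \<longlonglongrightarrow> 0"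
    using q by (intro tendsto_divide_zero LIMSEQ_realpow_zero) auto
qed

lemma euler_prod_holomorphic: "cmod q < 1 \<Longrightarrow> euler_prod q holomorphic_on A"
  unfolding euler_prod_def[abs_def]
  by (intro entire_powser_holomorphic euler_coeff_summable)

lemma euler_prod_compose_holomorphic:
  assumes "cmod q < 1" "f holomorphic_on A"
  shows "(\<lambda>u. euler_prod q (f u)) holomorphic_on A"
  using holomorphic_on_compose[OF assms(2) euler_prod_holomorphic[OF assms(1)]] by (simp add: o_def)

lemma euler_prod_0: "euler_prod q 0 = 1"
  unfolding euler_prod_def by (subst powser_zero) simp

lemma euler_prod_rec:
  assumes q: "cmod q < 1"
  shows "euler_prod q w = (1 - w) * euler_prod q (q * w)"
proof -
  note sm = euler_coeff_summable[OF q]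
  have "euler_prod q w - euler_prod q (q * w) =
      (\<Sum>n. euler_coeff q n * (1 - q ^ n) * w ^ n)"
    unfolding euler_prod_def suminf_diff[OF sm sm]
    by (simp add: algebra_simps power_mult_distrib)
  \<comment> \<open>The term n = 0 carries the factor 1 - q^0 = 0, so the sum may start at 1, where
    the recursion for the coefficients applies.\<close>
  also have "\<dots> = (\<Sum>n. euler_coeff q (Suc n) * (1 - q ^ Suc n) * w ^ Suc n)"
  proof -
    have "summable (\<lambda>n. euler_coeff q n * (1 - q ^ n) * w ^ n)"
      using summable_diff[OF sm[of w] sm[of "q * w"]]
      by (simp add: algebra_simps power_mult_distrib)
    from suminf_split_head[OF this] show ?thesis
      by simp
  qed
  also have "\<dots> = (\<Sum>n. - w * (euler_coeff q n * (q * w) ^ n))"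
    using one_minus_power_nz[OF q]
    by (intro suminf_cong) (simp add: power_mult_distrib field_simps)
  also have "\<dots> = - w * euler_prod q (q * w)"
    unfolding euler_prod_def by (rule suminf_mult[OF sm])
  finally show ?thesis
    by (simp add: algebra_simps)
qed

text \<open>If no q^n w equals 1, the functional equation passes a zero at w on to q w, q^2 w, ...,
  which tend to 0, while the value at 0 is 1. Conversely the factor 1 - w vanishes at 1, and the
  equation carries this zero back from q w to w.\<close>

lemma euler_prod_eq_0_iff:
  assumes q: "cmod q < 1"
  shows "euler_prod q w = 0 \<longleftrightarrow> (\<exists>n. q ^ n * w = 1)"
proof
  assume 0: "euler_prod q w = 0"
  show "\<exists>n. q ^ n * w = 1"
  proof (rule ccontr)
    assume nz: "\<nexists>n. q ^ n * w = 1"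
    have zero: "euler_prod q (q ^ n * w) = 0" for n
    proof (induction n)
      case (Suc n)
      then show ?case
        using nz euler_prod_rec[OF q, of "q ^ n * w"] by (simp add: mult.assoc)
    qed (use 0 in simp)
    have "(\<lambda>n. q ^ n * w) \<longlonglongrightarrow> 0"
      using q by (intro tendsto_mult_left_zero LIMSEQ_power_zero)
    moreover have "isCont (euler_prod q) 0"
      using holomorphic_on_imp_continuous_on[OF euler_prod_holomorphic[OF q, of UNIV]]
      by (simp add: continuous_on_eq_continuous_at)
    ultimately have "(\<lambda>n. euler_prod q (q ^ n * w)) \<longlonglongrightarrow> euler_prod q 0"
      by (rule isCont_tendsto_compose[rotated])
    then show False
      by (simp add: zero euler_prod_0 LIMSEQ_const_iff)
  qed
next
  assume "\<exists>n. q ^ n * w = 1"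
  then obtain n where "q ^ n * w = 1" ..
  then show "euler_prod q w = 0"
  proof (induction n arbitrary: w)
    case (Suc n)
    then show ?case
      using Suc.IH[of "q * w"] euler_prod_rec[OF q, of w] by (simp add: ac_simps)
  qed (use euler_prod_rec[OF q, of 1] in simp)
qed

abbreviation nome2 :: "complex \<Rightarrow> complex" where
  "nome2 \<tau> \<equiv> exp (2 * \<i> * pi * \<tau>)"

lemma norm_nome2: "Im \<tau> > 0 \<Longrightarrow> cmod (nome2 \<tau>) < 1"
  by simp

text \<open>Up to a constant, the Jacobi triple product for \<open>\<theta>\<close>.\<close>
definition theta_prod :: "complex \<Rightarrow> complex \<Rightarrow> complex" where
  "theta_prod u \<tau> = exp (\<i> * pi * u) * euler_prod (nome2 \<tau>) (exp (2 * \<i> * pi * (u + \<tau>))) *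
     euler_prod (nome2 \<tau>) (exp (2 * \<i> * pi * (- u)))"

lemma euler_prod_exp_eq_0_iff:
  assumes "Im \<tau> > 0"
  shows "euler_prod (nome2 \<tau>) (exp (2 * \<i> * pi * u)) = 0 \<longleftrightarrow>
    (\<exists>(n::nat) (k::int). u = of_int k - of_nat n * \<tau>)"
proof -
  have "nome2 \<tau> ^ n * exp (2 * \<i> * pi * u) = exp (2 * \<i> * pi * (of_nat n * \<tau> + u))" for n
    by (simp add: exp_of_nat_mult[symmetric] exp_add[symmetric] algebra_simps)
  then show ?thesis
    unfolding euler_prod_eq_0_iff[OF norm_nome2[OF assms]]
    by (simp only: exp_2pi_i_eq_1_iff) (auto simp: algebra_simps eq_diff_eq)
qed

text \<open>The shift by \<tau> in the first Euler factor keeps the two zero sets apart: the first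
  factor vanishes at the points k - (n + 1) \<tau>, the second at k + n \<tau>, and together they
  list each lattice point once.\<close>

lemma theta_prod_eq_0_iff:
  assumes \<tau>: "Im \<tau> > 0"
  shows "theta_prod u \<tau> = 0 \<longleftrightarrow> u \<in> lattice \<tau>"
proof -
  have "theta_prod u \<tau> = 0 \<longleftrightarrow> (\<exists>(n::nat) (k::int). u + \<tau> = of_int k - of_nat n * \<tau>) \<or>
      (\<exists>(n::nat) (k::int). - u = of_int k - of_nat n * \<tau>)"
    unfolding theta_prod_def mult_eq_0_iff euler_prod_exp_eq_0_iff[OF \<tau>] by simp
  also have "\<dots> \<longleftrightarrow> u \<in> lattice \<tau>"
  proof
    assume "(\<exists>(n::nat) (k::int). u + \<tau> = of_int k - of_nat n * \<tau>) \<or>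
      (\<exists>(n::nat) (k::int). - u = of_int k - of_nat n * \<tau>)"
    then show "u \<in> lattice \<tau>"
    proof (elim disjE exE)
      fix n k assume "u + \<tau> = of_int k - of_nat n * \<tau>"
      then have "u = of_int k + of_int (- int n - 1) * \<tau>"
        by (simp add: algebra_simps eq_diff_eq)
      then show ?thesis
        unfolding lattice_def by blast
    next
      fix n k assume "- u = of_int k - of_nat n * \<tau>"
      then have "u = of_int (- k) + of_int (int n) * \<tau>"
        by (simp add: algebra_simps minus_equation_iff[of u])
      then show ?thesis
        unfolding lattice_def by blast
    qed
  next
    assume "u \<in> lattice \<tau>"
    then obtain a b :: int where u: "u = of_int a + of_int b * \<tau>"
      unfolding lattice_def by blast
    show "(\<exists>(n::nat) (k::int). u + \<tau> = of_int k - of_nat n * \<tau>) \<or>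
      (\<exists>(n::nat) (k::int). - u = of_int k - of_nat n * \<tau>)"
    proof (cases "b < 0")
      case True
      then have "u + \<tau> = of_int a - of_nat (nat (- b - 1)) * \<tau>"
        unfolding u by (simp add: of_nat_nat algebra_simps)
      then show ?thesis
        by blast
    next
      case False
      then have "- u = of_int (- a) - of_nat (nat b) * \<tau>"
        unfolding u by (simp add: of_nat_nat algebra_simps)
      then show ?thesis
        by blast
    qed
  qed
  finally show ?thesis .
qed

lemma theta_prod_holomorphic:
  assumes "Im \<tau> > 0"
  shows "(\<lambda>u. theta_prod u \<tau>) holomorphic_on A"
  unfolding theta_prod_def
  by (intro holomorphic_intros euler_prod_compose_holomorphic norm_nome2 assms)

lemma exp_i_pi_add_1: "exp (\<i> * pi * (u + 1)) = - exp (\<i> * pi * u)"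
  by (simp add: distrib_left exp_add)

lemma exp_2_i_pi_add_1: "exp (2 * \<i> * pi * (u + 1)) = exp (2 * \<i> * pi * u)"
  using exp_2pi_i_eq_1_iff[of 1] of_int_1 by (metis distrib_left exp_add mult.right_neutral)

lemma theta_prod_add_1: "theta_prod (u + 1) \<tau> = - theta_prod u \<tau>"
proof -
  have "exp (2 * \<i> * pi * (u + 1 + \<tau>)) = exp (2 * \<i> * pi * (u + \<tau>))"
    using exp_2_i_pi_add_1[of "u + \<tau>"] by (simp add: add_ac)
  moreover have "exp (2 * \<i> * pi * (- (u + 1))) = exp (2 * \<i> * pi * (- u))"
    using exp_2_i_pi_add_1[of "- (u + 1)"] by simp
  ultimately show ?thesis
    unfolding theta_prod_def exp_i_pi_add_1 by simp
qed

text \<open>With x = exp(2 i pi (u + \<tau>)), the shift turns (x; q)(q/x; q) into (q x; q)(1/x; q).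
  One use of the functional equation on each factor leaves (1 - 1/x) / (1 - x) = -1/x. Off the
  lattice 1 - x is non-zero and may be divided by.\<close>

lemma theta_prod_add_tau:
  assumes \<tau>: "Im \<tau> > 0" and u: "u \<notin> lattice \<tau>"
  shows "theta_prod (u + \<tau>) \<tau> = - exp (- \<i> * pi * \<tau> - 2 * \<i> * pi * u) * theta_prod u \<tau>"
proof -
  define q where "q = nome2 \<tau>"
  define x where "x = exp (2 * \<i> * pi * (u + \<tau>))"
  have "x \<noteq> 1"
  proof
    assume "x = 1"
    then obtain k :: int where "u + \<tau> = of_int k"
      unfolding x_def exp_2pi_i_eq_1_iff ..
    then have "u = of_int k + of_int (- 1) * \<tau>"
      by (simp add: algebra_simps eq_diff_eq)
    with u show False
      unfolding lattice_def by blast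
  qed
  have q1: "cmod q < 1"
    unfolding q_def by (rule norm_nome2[OF \<tau>])
  have x0: "x \<noteq> 0"
    by (simp add: x_def)
  have e1: "exp (2 * \<i> * pi * (u + \<tau> + \<tau>)) = q * x"
    unfolding q_def x_def by (simp add: exp_add[symmetric] algebra_simps)
  have e2: "exp (2 * \<i> * pi * (- (u + \<tau>))) = 1 / x"
    unfolding x_def by (simp only: mult_minus_right exp_minus inverse_eq_divide)
  have e3: "exp (2 * \<i> * pi * (- u)) = q * (1 / x)"
    unfolding q_def x_def by (simp add: exp_diff[symmetric] algebra_simps)
  have e4: "exp (- \<i> * pi * \<tau> - 2 * \<i> * pi * u) * exp (\<i> * pi * u) = exp (\<i> * pi * (u + \<tau>)) / x"
    unfolding x_def by (simp add: exp_add[symmetric] exp_diff[symmetric] algebra_simps)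
  have "theta_prod (u + \<tau>) \<tau> = exp (\<i> * pi * (u + \<tau>)) * euler_prod q (q * x) * euler_prod q (1 / x)"
    unfolding theta_prod_def e1 e2 q_def ..
  also have "euler_prod q (1 / x) = (1 - 1 / x) * euler_prod q (q * (1 / x))"
    by (rule euler_prod_rec[OF q1])
  also have "euler_prod q (q * x) = euler_prod q x / (1 - x)"
    using euler_prod_rec[OF q1, of x] \<open>x \<noteq> 1\<close> by simp
  also have "exp (\<i> * pi * (u + \<tau>)) * (euler_prod q x / (1 - x)) * ((1 - 1 / x) * euler_prod q (q * (1 / x))) =
      - (exp (\<i> * pi * (u + \<tau>)) / x) * (euler_prod q x * euler_prod q (q * (1 / x)))"
    using \<open>x \<noteq> 1\<close> x0 by (simp add: field_simps)
  also have "\<dots> = - exp (- \<i> * pi * \<tau> - 2 * \<i> * pi * u) * theta_prod u \<tau>"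
    unfolding theta_prod_def e4[symmetric] e3 q_def[symmetric] x_def[symmetric] by simp
  finally show ?thesis .
qed

text \<open>One step of the functional equation splits off 1 - exp(-2 i pi u), which has a simple
  zero at 0. The remaining factor \<open>G\<close> has the value \<open>(euler_prod q q)^2\<close>
  there, which is non-zero.\<close>

lemma deriv_theta_prod_0:
  assumes \<tau>: "Im \<tau> > 0"
  shows "deriv (\<lambda>u. theta_prod u \<tau>) 0 \<noteq> 0"
proof -
  define q where "q = nome2 \<tau>"
  have q1: "cmod q < 1"
    unfolding q_def by (rule norm_nome2[OF \<tau>])
  define G where "G u = exp (\<i> * pi * u) * euler_prod q (exp (2 * \<i> * pi * (u + \<tau>))) *
     euler_prod q (q * exp (- 2 * \<i> * pi * u))" for u
  have "G holomorphic_on UNIV"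
    unfolding G_def
    by (intro holomorphic_intros euler_prod_compose_holomorphic[OF q1])
  then obtain G' where G': "(G has_field_derivative G') (at 0)"
    using holomorphic_derivI[OF _ open_UNIV UNIV_I] by blast
  have "(\<lambda>u. theta_prod u \<tau>) = (\<lambda>u. (1 - exp (- 2 * \<i> * pi * u)) * G u)"
  proof
    fix u
    have "euler_prod q (exp (2 * \<i> * pi * (- u))) =
        (1 - exp (- 2 * \<i> * pi * u)) * euler_prod q (q * exp (- 2 * \<i> * pi * u))"
      using euler_prod_rec[OF q1, of "exp (- 2 * \<i> * pi * u)"] by simp
    then show "theta_prod u \<tau> = (1 - exp (- 2 * \<i> * pi * u)) * G u"
      unfolding theta_prod_def G_def q_def[symmetric] by (simp only: ac_simps)
  qed
  moreover have "((\<lambda>u. (1 - exp (- 2 * \<i> * pi * u)) * G u) has_field_derivative 2 * \<i> * pi * G 0) (at 0)"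
    using G' by (auto intro!: derivative_eq_intros)
  ultimately have "deriv (\<lambda>u. theta_prod u \<tau>) 0 = 2 * \<i> * pi * G 0"
    by (simp add: DERIV_imp_deriv)
  moreover have "G 0 \<noteq> 0"
  proof -
    have "euler_prod q q \<noteq> 0"
      unfolding euler_prod_eq_0_iff[OF q1] power_Suc2[symmetric]
      using one_minus_power_nz[OF q1] by (metis diff_self)
    then show ?thesis
      unfolding G_def by (simp add: q_def)
  qed
  ultimately show ?thesis
    by simp
qed

subsection \<open>Zeros of the theta function\<close>

definition theta_coeff :: "complex \<Rightarrow> nat \<Rightarrow> complex" where
  "theta_coeff \<tau> k = (-1) ^ k * exp (\<i> * pi * (of_nat k + 1/2)\<^sup>2 * \<tau>)"

text \<open>The terms k \<ge> 0 of the sum, divided by exp(i pi u) and written in w = exp(2 i pi u).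
  Splitting the Laurent series this way leaves only power series, to which the ratio test and
  Liouville's theorem apply.\<close>

definition theta_half :: "complex \<Rightarrow> complex \<Rightarrow> complex" where
  "theta_half \<tau> w = (\<Sum>k. theta_coeff \<tau> k * w ^ k)"

text \<open>(k + 3/2)^2 - (k + 1/2)^2 = 2 (k + 1), so the ratio of consecutive coefficients tends to
  0.\<close>

lemma theta_coeff_Suc: "theta_coeff \<tau> (Suc k) = - (nome2 \<tau> ^ Suc k) * theta_coeff \<tau> k"
proof -
  have "\<i> * pi * (of_nat (Suc k) + 1/2)\<^sup>2 * \<tau> =
      of_nat (Suc k) * (2 * \<i> * pi * \<tau>) + \<i> * pi * (of_nat k + 1/2)\<^sup>2 * \<tau>"
    by (simp add: power2_eq_square algebra_simps)
  then have "exp (\<i> * pi * (of_nat (Suc k) + 1/2)\<^sup>2 * \<tau>) =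
      nome2 \<tau> ^ Suc k * exp (\<i> * pi * (of_nat k + 1/2)\<^sup>2 * \<tau>)"
    by (simp only: exp_add exp_of_nat_mult)
  then show ?thesis
    unfolding theta_coeff_def by simp
qed

lemma theta_coeff_abs_summable:
  assumes "Im \<tau> > 0"
  shows "summable (\<lambda>k. cmod (theta_coeff \<tau> k * w ^ k))"
proof (rule entire_powser_summable)
  show "cmod (theta_coeff \<tau> (Suc n)) \<le> cmod (nome2 \<tau>) ^ Suc n * cmod (theta_coeff \<tau> n)" for n
    by (simp only: theta_coeff_Suc norm_mult norm_minus_cancel norm_power order_refl)
  show "(\<lambda>n. cmod (nome2 \<tau>) ^ Suc n) \<longlonglongrightarrow> 0"
    by (intro LIMSEQ_Suc LIMSEQ_realpow_zero norm_nome2 assms norm_ge_zero)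
qed

lemma theta_half_holomorphic:
  assumes "Im \<tau> > 0"
  shows "theta_half \<tau> holomorphic_on A"
  unfolding theta_half_def[abs_def]
  by (intro entire_powser_holomorphic summable_norm_cancel[OF theta_coeff_abs_summable] assms)

lemma theta_half_0: "theta_half \<tau> 0 \<noteq> 0"
  unfolding theta_half_def by (subst powser_zero) (simp add: theta_coeff_def)

text \<open>The reflection k -> -k - 1 exchanges the two halves of the integers. It negates k + 1/2,
  keeps its square and flips the sign (-1)^k, so the negative half is minus the positive one at -u.
  The formula makes \<theta> visibly odd.\<close>

lemma theta_eq:
  assumes \<tau>: "Im \<tau> > 0"
  shows "theta u \<tau> = - \<i> * (exp (\<i> * pi * u) * theta_half \<tau> (exp (2 * \<i> * pi * u)) -
    exp (- (\<i> * pi * u)) * theta_half \<tau> (exp (- (2 * \<i> * pi * u))))"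
proof -
  define t where "t k = (-1) powi k *
     exp (\<i> * pi * (of_int k + 1/2)\<^sup>2 * \<tau> + 2 * \<i> * pi * (of_int k + 1/2) * u)" for k :: int
  have half: "((\<lambda>k. theta_coeff \<tau> k * w ^ k) has_sum theta_half \<tau> w) UNIV" for w
    unfolding theta_half_def
    by (intro norm_summable_imp_has_sum theta_coeff_abs_summable[OF \<tau>] summable_sums
        summable_norm_cancel[OF theta_coeff_abs_summable[OF \<tau>]])
  define g where "g = (\<lambda>k. - int k - 1)"
  have "t (int k) = exp (\<i> * pi * u) * (theta_coeff \<tau> k * exp (2 * \<i> * pi * u) ^ k)" for k
  proof -
    have "\<i> * pi * (of_nat k + 1/2)\<^sup>2 * \<tau> + 2 * \<i> * pi * (of_nat k + 1/2) * u =
        \<i> * pi * u + (\<i> * pi * (of_nat k + 1/2)\<^sup>2 * \<tau> + of_nat k * (2 * \<i> * pi * u))"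
      by (simp add: algebra_simps)
    then have "exp (\<i> * pi * (of_nat k + 1/2)\<^sup>2 * \<tau> + 2 * \<i> * pi * (of_nat k + 1/2) * u) =
        exp (\<i> * pi * u) * (exp (\<i> * pi * (of_nat k + 1/2)\<^sup>2 * \<tau>) * exp (2 * \<i> * pi * u) ^ k)"
      by (simp only: exp_add exp_of_nat_mult)
    then show ?thesis
      unfolding t_def theta_coeff_def by simp
  qed
  then have "t \<circ> int = (\<lambda>k. exp (\<i> * pi * u) * (theta_coeff \<tau> k * exp (2 * \<i> * pi * u) ^ k))"
    by (simp add: fun_eq_iff)
  then have pos: "(t has_sum exp (\<i> * pi * u) * theta_half \<tau> (exp (2 * \<i> * pi * u))) (range int)"
    by (subst has_sum_reindex) (auto intro!: has_sum_cmult_right half)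
  have "t (g k) = - exp (- (\<i> * pi * u)) * (theta_coeff \<tau> k * exp (- (2 * \<i> * pi * u)) ^ k)" for k
  proof -
    have "\<i> * pi * (of_int (g k) + 1/2)\<^sup>2 * \<tau> + 2 * \<i> * pi * (of_int (g k) + 1/2) * u =
        - (\<i> * pi * u) + (\<i> * pi * (of_nat k + 1/2)\<^sup>2 * \<tau> + of_nat k * (- (2 * \<i> * pi * u)))"
      unfolding g_def by (simp add: algebra_simps power2_eq_square)
    then have "exp (\<i> * pi * (of_int (g k) + 1/2)\<^sup>2 * \<tau> + 2 * \<i> * pi * (of_int (g k) + 1/2) * u) =
        exp (- (\<i> * pi * u)) * (exp (\<i> * pi * (of_nat k + 1/2)\<^sup>2 * \<tau>) * exp (- (2 * \<i> * pi * u)) ^ k)"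
      by (simp only: exp_add exp_of_nat_mult)
    moreover have "(-1 :: complex) powi (g k) = - ((-1) ^ k)"
    proof -
      have "g k = - int (Suc k)"
        by (simp add: g_def)
      then show ?thesis
        by (simp only: power_int_minus power_int_of_nat) (simp add: power_inverse[symmetric])
    qed
    ultimately show ?thesis
      unfolding t_def theta_coeff_def by simp
  qed
  then have "t \<circ> g = (\<lambda>k. - exp (- (\<i> * pi * u)) * (theta_coeff \<tau> k * exp (- (2 * \<i> * pi * u)) ^ k))"
    by (simp add: fun_eq_iff)
  moreover have "inj g"
    by (auto simp: g_def inj_on_def)
  ultimately have neg: "(t has_sum - exp (- (\<i> * pi * u)) * theta_half \<tau> (exp (- (2 * \<i> * pi * u)))) (range g)"
    using has_sum_cmult_right[OF half] by (simp only: has_sum_reindex)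
  have "range int \<inter> range g = {}"
    by (auto simp: g_def)
  moreover have "range int \<union> range g = UNIV"
  proof -
    have "k \<in> range int \<union> range g" for k
      by (cases "k \<ge> 0") (auto simp: g_def image_iff intro: exI[of _ "nat k"] exI[of _ "nat (- k - 1)"])
    then show ?thesis
      by blast
  qed
  ultimately have "(t has_sum exp (\<i> * pi * u) * theta_half \<tau> (exp (2 * \<i> * pi * u)) +
      - exp (- (\<i> * pi * u)) * theta_half \<tau> (exp (- (2 * \<i> * pi * u)))) UNIV"
    using has_sum_Un_disjoint[OF pos neg] by simp
  then have "infsum t UNIV = exp (\<i> * pi * u) * theta_half \<tau> (exp (2 * \<i> * pi * u)) +
      - exp (- (\<i> * pi * u)) * theta_half \<tau> (exp (- (2 * \<i> * pi * u)))"
    by (rule infsumI)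
  moreover have "theta u \<tau> = - \<i> * infsum t UNIV"
    unfolding theta_def t_def ..
  ultimately show ?thesis
    by simp
qed

section \<open>Holomorphy and multipliers of \<theta>\<close>

lemma theta_holomorphic:
  assumes "Im \<tau> > 0"
  shows "(\<lambda>u. theta u \<tau>) holomorphic_on A"
proof -
  have half: "(\<lambda>u. theta_half \<tau> (f u)) holomorphic_on A" if "f holomorphic_on A" for f
    using holomorphic_on_compose[OF that theta_half_holomorphic[OF assms]] by (simp add: o_def)
  show ?thesis
    unfolding theta_eq[OF assms] by (intro holomorphic_intros half)
qed

lemma theta_0: "Im \<tau> > 0 \<Longrightarrow> theta 0 \<tau> = 0"
  by (simp add: theta_eq)

lemma theta_add_1:
  assumes "Im \<tau> > 0"
  shows "theta (u + 1) \<tau> = - theta u \<tau>"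
  unfolding theta_eq[OF assms] exp_minus exp_i_pi_add_1 exp_2_i_pi_add_1
  by (simp add: algebra_simps)

text \<open>An index shift: (k + 1/2)^2 \<tau> + 2 (k + 1/2)(u + \<tau>) equals (k + 3/2)^2 \<tau> +
  2 (k + 3/2) u, the exponent of the next term at u, minus \<tau> + 2 u. The sign comes from (-1)^k
  = -(-1)^(k+1).\<close>

lemma theta_add_tau: "theta (u + \<tau>) \<tau> = - exp (- \<i> * pi * \<tau> - 2 * \<i> * pi * u) * theta u \<tau>"
proof -
  define t where "t k = (-1) powi k *
     exp (\<i> * pi * (of_int k + 1/2)\<^sup>2 * \<tau> + 2 * \<i> * pi * (of_int k + 1/2) * u)" for k :: int
  have shift: "(-1) powi k * exp (\<i> * pi * (of_int k + 1/2)\<^sup>2 * \<tau> + 2 * \<i> * pi * (of_int k + 1/2) * (u + \<tau>)) =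
      - exp (- \<i> * pi * \<tau> - 2 * \<i> * pi * u) * t (k + 1)" for k :: int
  proof -
    have "\<i> * pi * (of_int k + 1/2)\<^sup>2 * \<tau> + 2 * \<i> * pi * (of_int k + 1/2) * (u + \<tau>) =
        (- \<i> * pi * \<tau> - 2 * \<i> * pi * u) +
        (\<i> * pi * (of_int (k + 1) + 1/2)\<^sup>2 * \<tau> + 2 * \<i> * pi * (of_int (k + 1) + 1/2) * u)"
      by (simp add: power2_eq_square algebra_simps)
    then have "exp (\<i> * pi * (of_int k + 1/2)\<^sup>2 * \<tau> + 2 * \<i> * pi * (of_int k + 1/2) * (u + \<tau>)) =
        exp (- \<i> * pi * \<tau> - 2 * \<i> * pi * u) *
        exp (\<i> * pi * (of_int (k + 1) + 1/2)\<^sup>2 * \<tau> + 2 * \<i> * pi * (of_int (k + 1) + 1/2) * u)"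
      by (simp only: exp_add)
    moreover have "(-1 :: complex) powi (k + 1) = - ((-1) powi k)"
      by (simp add: power_int_add)
    ultimately show ?thesis
      unfolding t_def by simp
  qed
  have "theta (u + \<tau>) \<tau> = - \<i> * (- exp (- \<i> * pi * \<tau> - 2 * \<i> * pi * u) * infsum (\<lambda>k. t (k + 1)) UNIV)"
    unfolding theta_def shift infsum_cmult_right' ..
  also have "infsum (\<lambda>k. t (k + 1)) UNIV = infsum t UNIV"
    by (rule infsum_reindex_bij_betw) (rule bij_plus_right)
  finally show ?thesis
    unfolding theta_def t_def by simp
qed

text \<open>
  If \<open>\<theta>\<close> vanished identically, then \<open>theta_half\<close> would satisfy \<open>A(w) = A(1/w) / w\<close>, so it would
  tend to \<open>0\<close> at infinity and be \<open>0\<close> by Liouville's theorem.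
\<close>
lemma theta_not_identically_0:
  assumes \<tau>: "Im \<tau> > 0"
  shows "\<exists>u. theta u \<tau> \<noteq> 0"
proof (rule ccontr)
  assume "\<nexists>u. theta u \<tau> \<noteq> 0"
  then have zero: "theta u \<tau> = 0" for u
    by blast
  let ?A = "theta_half \<tau>"
  have eq: "inverse w * ?A (inverse w) = ?A w" if "w \<noteq> 0" for w
  proof -
    \<comment> \<open>Every non-zero w is some exp(2 i pi u), so the vanishing of \<theta> at u
      relates the half series at w and at 1/w.\<close>
    define u where "u = Ln w / (2 * \<i> * pi)"
    have w: "exp (2 * \<i> * pi * u) = w"
      using that by (simp add: u_def)
    have "exp (\<i> * pi * u) * ?A w = exp (- (\<i> * pi * u)) * ?A (inverse w)"
      using zero[of u] unfolding theta_eq[OF \<tau>] exp_minus[of "2 * \<i> * pi * u"] w by simp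
    then have "exp (- (\<i> * pi * u)) * (exp (\<i> * pi * u) * ?A w) =
        exp (- (\<i> * pi * u)) * exp (- (\<i> * pi * u)) * ?A (inverse w)"
      by (simp only: mult.assoc)
    moreover have "exp (- (\<i> * pi * u)) * exp (- (\<i> * pi * u)) = inverse w"
      unfolding w[symmetric] exp_minus[symmetric] exp_add[symmetric] by (simp add: algebra_simps)
    moreover have "exp (- (\<i> * pi * u)) * (exp (\<i> * pi * u) * ?A w) = ?A w"
      by (simp add: exp_minus)
    ultimately show ?thesis
      by metis
  qed
  have "isCont ?A 0"
    using holomorphic_on_imp_continuous_on[OF theta_half_holomorphic[OF \<tau>, of UNIV]]
    by (simp add: continuous_on_eq_continuous_at)
  then have "((\<lambda>w. inverse w * ?A (inverse w)) \<longlongrightarrow> 0 * ?A 0) at_infinity"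
    by (intro tendsto_mult tendsto_inverse_0 isCont_tendsto_compose[of 0 ?A])
  then have "((\<lambda>w. inverse w * ?A (inverse w)) \<longlongrightarrow> 0) at_infinity"
    by simp
  moreover have "\<forall>\<^sub>F w in at_infinity. inverse w * ?A (inverse w) = ?A w"
    unfolding eventually_at_infinity
  proof (intro exI[of _ 1] allI impI)
    fix w :: complex assume "1 \<le> norm w"
    then have "w \<noteq> 0"
      by auto
    then show "inverse w * ?A (inverse w) = ?A w"
      by (rule eq)
  qed
  ultimately have "(?A \<longlongrightarrow> 0) at_infinity"
    by (rule Lim_transform_eventually)
  then have "?A 0 = 0"
    by (rule Liouville_weak[OF theta_half_holomorphic[OF \<tau>]])
  then show False
    using theta_half_0 by simp
qed

text \<open>The lattice is closed as the zero set of the continuous function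
  \<open>theta_prod\<close>.\<close>

lemma open_lattice_compl:
  assumes "Im \<tau> > 0"
  shows "open (- lattice \<tau>)"
proof -
  have "continuous_on UNIV (\<lambda>u. theta_prod u \<tau>)"
    by (rule holomorphic_on_imp_continuous_on[OF theta_prod_holomorphic[OF assms]])
  then have "closed {u. theta_prod u \<tau> = 0}"
    by (rule closed_Collect_eq) simp
  then show ?thesis
    by (simp add: theta_prod_eq_0_iff[OF assms] closed_def)
qed

section \<open>Local factors and logarithms of holomorphic functions\<close>

lemma divide_zero_holomorphic:
  fixes f :: "complex \<Rightarrow> complex"
  assumes "f holomorphic_on S" "open S" "p \<in> S" "f p = 0"
  obtains k where "k holomorphic_on S" "k p = deriv f p" "\<And>u. u \<in> S \<Longrightarrow> f u = (u - p) * k u"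
proof
  define k where "k = (\<lambda>u. if u = p then deriv f p else (f u - f p) / (u - p))"
  show "k holomorphic_on S"
    unfolding k_def using assms by (intro pole_lemma) (auto simp: interior_open)
  show "k p = deriv f p" "\<And>u. u \<in> S \<Longrightarrow> f u = (u - p) * k u"
    using assms(4) by (auto simp: k_def)
qed

lemma holomorphic_nonzero_ball:
  fixes f :: "complex \<Rightarrow> complex"
  assumes "f holomorphic_on S" "open S" "p \<in> S" "f p \<noteq> 0"
  obtains \<epsilon> where "\<epsilon> > 0" "ball p \<epsilon> \<subseteq> S" "\<And>u. u \<in> ball p \<epsilon> \<Longrightarrow> f u \<noteq> 0"
proof -
  have "open {u \<in> S. f u \<noteq> 0}"
    using continuous_open_preimage[OF holomorphic_on_imp_continuous_on[OF assms(1)] assms(2), of "- {0}"]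
    by (simp add: vimage_def Int_def open_Compl)
  then obtain \<epsilon> where "\<epsilon> > 0" "ball p \<epsilon> \<subseteq> {u \<in> S. f u \<noteq> 0}"
    using assms(3,4) by (metis (mono_tags, lifting) mem_Collect_eq open_contains_ball)
  then show thesis
    using that by blast
qed

lemma holomorphic_nonzero_log:
  fixes f :: "complex \<Rightarrow> complex"
  assumes "f holomorphic_on S" "open S" "p \<in> S" "f p \<noteq> 0"
  obtains \<epsilon> L where "\<epsilon> > 0" "ball p \<epsilon> \<subseteq> S" "L holomorphic_on ball p \<epsilon>"
    "\<And>u. u \<in> ball p \<epsilon> \<Longrightarrow> f u = exp (L u)"
proof -
  obtain \<epsilon> where \<epsilon>: "\<epsilon> > 0" "ball p \<epsilon> \<subseteq> S" "\<And>u. u \<in> ball p \<epsilon> \<Longrightarrow> f u \<noteq> 0"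
    using holomorphic_nonzero_ball[OF assms] by blast
  obtain L where "L holomorphic_on ball p \<epsilon>" "\<And>u. u \<in> ball p \<epsilon> \<Longrightarrow> exp (L u) = f u"
    using \<epsilon> holomorphic_on_subset[OF assms(1)]
    by (metis holomorphic_logarithm_exists centre_in_ball convex_ball open_ball)
  then show thesis
    using that \<epsilon> by metis
qed

text \<open>Both functions have the same multipliers under u + 1 and u + \<tau>, so the quotient of
  moduli descends to the torus. Its only possible poles are the lattice points, where \<theta>
  vanishes too and the zero of \<open>theta_prod\<close> is simple.\<close>

lemma theta_eq_theta_prod:
  assumes \<tau>: "Im \<tau> > 0"
  obtains c where "c > 0" "\<And>u. cmod (theta u \<tau>) = c * cmod (theta_prod u \<tau>)"
proof -
  let ?q = "\<lambda>u. cmod (theta u \<tau>) / cmod (theta_prod u \<tau>)"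
  note holP = theta_prod_holomorphic[OF \<tau>] and holT = theta_holomorphic[OF \<tau>]
  have per1: "?q (u + 1) = ?q u" for u
    by (simp add: theta_add_1[OF \<tau>] theta_prod_add_1)
  have per\<tau>: "?q (u + \<tau>) = ?q u" for u
  proof (cases "u \<in> lattice \<tau>")
    \<comment> \<open>Here both denominators are 0, and division by 0 gives 0 on each side.\<close>
    case True
    have "\<tau> = of_int 0 + of_int 1 * \<tau>"
      by simp
    then have "\<tau> \<in> lattice \<tau>"
      unfolding lattice_def by blast
    then have "u + \<tau> \<in> lattice \<tau>"
      using True by (rule lattice_add[rotated])
    with True show ?thesis
      by (simp add: theta_prod_eq_0_iff[OF \<tau>, THEN iffD2])
  next
    case False
    show ?thesis
      unfolding theta_add_tau theta_prod_add_tau[OF \<tau> False] by (simp add: norm_mult)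
  qed
  have per: "?q (u + l) = ?q u" if "l \<in> lattice \<tau>" for u l
    by (rule lattice_periodic[of ?q, OF per1 per\<tau> that])
  have th0: "theta l \<tau> = 0" if "l \<in> lattice \<tau>" for l
  proof -
    \<comment> \<open>\<open>lattice_periodic\<close> is applied to a truth value: the multipliers
      never vanish, so being a zero is a periodic property.\<close>
    let ?t = "\<lambda>u. theta u \<tau> = 0"
    have "?t (0 + l) = ?t 0"
      by (rule lattice_periodic[OF _ _ that]) (simp_all add: theta_add_1[OF \<tau>] theta_add_tau)
    then show ?thesis
      by (simp add: theta_0[OF \<tau>])
  qed
  obtain c where c: "\<And>u. u \<in> - lattice \<tau> \<Longrightarrow> ?q u = c"
  proof (rule torus_locally_modulus_constant[OF \<tau>, of "- lattice \<tau>" ?q])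
    show "u + l \<in> - lattice \<tau>" if "u \<in> - lattice \<tau>" "l \<in> lattice \<tau>" for u l
      using that by (simp add: lattice_add_cancel)
    show "?q (u + l) = ?q u" if "l \<in> lattice \<tau>" for u l
      by (rule per[OF that])
    show "\<exists>l\<in>lattice \<tau>. \<exists>\<epsilon>>0. \<exists>g. g holomorphic_on ball (p + l) \<epsilon> \<and>
      ball (p + l) \<epsilon> - {p + l} \<subseteq> - lattice \<tau> \<and> (\<forall>u\<in>ball (p + l) \<epsilon> \<inter> - lattice \<tau>. ?q u = cmod (g u))" for p
    proof (cases "p \<in> lattice \<tau>")
      case True
      \<comment> \<open>The translate by \<open>- p\<close> moves the lattice point to 0. Cancelling
        u in both functions shows that the quotient extends there as \<open>kT / kP\<close>.\<close>
      obtain kT where kT: "kT holomorphic_on UNIV" "\<And>u. theta u \<tau> = u * kT u"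
        using divide_zero_holomorphic[OF holT[of UNIV], of 0] theta_0[OF \<tau>] by auto
      have "theta_prod 0 \<tau> = 0"
        by (simp add: theta_prod_eq_0_iff[OF \<tau>])
      from divide_zero_holomorphic[OF holP open_UNIV UNIV_I this] deriv_theta_prod_0[OF \<tau>]
      obtain kP where kP: "kP holomorphic_on UNIV" "kP 0 \<noteq> 0" "\<And>u. theta_prod u \<tau> = u * kP u"
        by (metis UNIV_I diff_zero)
      obtain \<epsilon> where \<epsilon>: "\<epsilon> > 0" "\<And>u. u \<in> ball 0 \<epsilon> \<Longrightarrow> kP u \<noteq> 0"
        using holomorphic_nonzero_ball[OF kP(1) open_UNIV UNIV_I kP(2)] by metis
      have "ball 0 \<epsilon> - {0} \<subseteq> - lattice \<tau>"
      proof
        fix u :: complex assume "u \<in> ball 0 \<epsilon> - {0}"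
        then have "theta_prod u \<tau> \<noteq> 0"
          unfolding kP(3) using \<epsilon>(2)[of u] by simp
        then show "u \<in> - lattice \<tau>"
          by (simp add: theta_prod_eq_0_iff[OF \<tau>])
      qed
      moreover have "(\<lambda>u. kT u / kP u) holomorphic_on ball 0 \<epsilon>"
        using \<epsilon>(2) by (intro holomorphic_intros holomorphic_on_subset[OF kT(1)] holomorphic_on_subset[OF kP(1)]) auto
      moreover have "?q u = cmod (kT u / kP u)" if "u \<in> - lattice \<tau>" for u
      proof -
        have "u \<noteq> 0"
          using that by auto
        then show ?thesis
          by (simp add: kT(2) kP(3) norm_mult norm_divide)
      qed
      ultimately show ?thesis
        using \<epsilon>(1) lattice_minus[OF True]
        by (intro bexI[of _ "- p"] exI[of _ \<epsilon>] conjI exI[of _ "\<lambda>u. kT u / kP u"]) auto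
    next
      case False
      then obtain \<epsilon> where \<epsilon>: "\<epsilon> > 0" "ball p \<epsilon> \<subseteq> - lattice \<tau>"
        using open_lattice_compl[OF \<tau>] by (metis ComplI open_contains_ball)
      have "(\<lambda>u. theta u \<tau> / theta_prod u \<tau>) holomorphic_on ball p \<epsilon>"
        using \<epsilon>(2) by (intro holomorphic_intros holT holP) (auto simp: theta_prod_eq_0_iff[OF \<tau>])
      then show ?thesis
        using \<epsilon> by (intro bexI[of _ 0] exI[of _ \<epsilon>] conjI exI[of _ "\<lambda>u. theta u \<tau> / theta_prod u \<tau>"])
          (auto simp: norm_divide)
    qed
  qed (rule that)
  have eq: "cmod (theta u \<tau>) = c * cmod (theta_prod u \<tau>)" for u
  proof (cases "u \<in> lattice \<tau>")
    case True
    then show ?thesis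
      using th0 theta_prod_eq_0_iff[OF \<tau>] by simp
  next
    case False
    then show ?thesis
      using c[of u] theta_prod_eq_0_iff[OF \<tau>, of u] by (simp add: divide_eq_eq)
  qed
  obtain u where "theta u \<tau> \<noteq> 0"
    using theta_not_identically_0[OF \<tau>] by blast
  then have "0 < c * cmod (theta_prod u \<tau>)"
    unfolding eq[symmetric] by simp
  then have "c > 0"
    by (simp add: zero_less_mult_iff)
  then show thesis
    using eq that by blast
qed

lemma theta_eq_0_iff:
  assumes "Im \<tau> > 0"
  shows "theta u \<tau> = 0 \<longleftrightarrow> u \<in> lattice \<tau>"
proof -
  obtain c where "c > 0" "cmod (theta u \<tau>) = c * cmod (theta_prod u \<tau>)"
    using theta_eq_theta_prod[OF assms] by metis
  then show ?thesis
    using theta_prod_eq_0_iff[OF assms, of u] by (metis mult_eq_0_iff norm_eq_zero less_irrefl)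
qed

text \<open>Proportional moduli have proportional limits of |f(u) / u| at 0, that is, proportional
  |f'(0)|; for \<open>theta_prod\<close> this number is known to be non-zero.\<close>

lemma deriv_theta_0:
  assumes \<tau>: "Im \<tau> > 0"
  shows "deriv (\<lambda>u. theta u \<tau>) 0 \<noteq> 0"
proof
  assume d0: "deriv (\<lambda>u. theta u \<tau>) 0 = 0"
  obtain c where c: "c > 0" "\<And>u. cmod (theta u \<tau>) = c * cmod (theta_prod u \<tau>)"
    using theta_eq_theta_prod[OF assms] by metis
  have quot: "((\<lambda>u. f u / u) \<longlongrightarrow> deriv f 0) (at 0)" if "f holomorphic_on UNIV" "f 0 = 0"
    for f :: "complex \<Rightarrow> complex"
    using holomorphic_derivI[OF that(1) open_UNIV UNIV_I, of 0 UNIV]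
    by (simp add: has_field_derivative_iff that(2))
  have "((\<lambda>u. cmod (theta u \<tau> / u)) \<longlongrightarrow> cmod 0) (at 0)"
    using quot[OF theta_holomorphic[OF \<tau>] theta_0[OF \<tau>]] unfolding d0 by (rule tendsto_norm)
  moreover have "theta_prod 0 \<tau> = 0"
    by (simp add: theta_prod_eq_0_iff[OF \<tau>])
  then have "((\<lambda>u. c * cmod (theta_prod u \<tau> / u)) \<longlongrightarrow> c * cmod (deriv (\<lambda>u. theta_prod u \<tau>) 0)) (at 0)"
    using quot[OF theta_prod_holomorphic[OF \<tau>]] by (intro tendsto_intros)
  ultimately have "cmod 0 = c * cmod (deriv (\<lambda>u. theta_prod u \<tau>) 0)"
    by (intro tendsto_unique[OF trivial_limit_at]) (auto simp: c(2) norm_divide)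
  then show False
    using c(1) deriv_theta_prod_0[OF \<tau>] by simp
qed

text \<open>One formula for a zero and for a non-zero of \<theta>, so that \<open>T_local\<close>
  can treat all factors \<theta>(u - z_i) at once: a simple zero stays outside as the factor u, and
  the rest has a logarithm.\<close>

lemma theta_local_log:
  assumes \<tau>: "Im \<tau> > 0" and p: "p = 0 \<or> p \<notin> lattice \<tau>"
  obtains \<epsilon> L where "\<epsilon> > 0" "L holomorphic_on ball p \<epsilon>"
    "\<And>u. u \<in> ball p \<epsilon> \<Longrightarrow> theta u \<tau> = (if p = 0 then u else 1) * exp (L u)"
proof (cases "p = 0")
  case True
  obtain k where k: "k holomorphic_on UNIV" "k 0 \<noteq> 0" "\<And>u. theta u \<tau> = u * k u"
    using divide_zero_holomorphic[OF theta_holomorphic[OF \<tau>] open_UNIV UNIV_I theta_0[OF \<tau>]]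
      deriv_theta_0[OF \<tau>] by (metis UNIV_I diff_zero)
  obtain \<epsilon> L where "\<epsilon> > 0" "L holomorphic_on ball 0 \<epsilon>" "\<And>u. u \<in> ball 0 \<epsilon> \<Longrightarrow> k u = exp (L u)"
    using holomorphic_nonzero_log[OF k(1) open_UNIV UNIV_I k(2)] by metis
  then show thesis
    using that[of \<epsilon> L] True k(3) by simp
next
  case False
  then have "theta p \<tau> \<noteq> 0"
    using p theta_eq_0_iff[OF \<tau>] by blast
  then obtain \<epsilon> L where "\<epsilon> > 0" "L holomorphic_on ball p \<epsilon>"
      "\<And>u. u \<in> ball p \<epsilon> \<Longrightarrow> theta u \<tau> = exp (L u)"
    using holomorphic_nonzero_log[OF theta_holomorphic[OF \<tau>] open_UNIV UNIV_I] by metis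
  then show thesis
    using that[of \<epsilon> L] False by simp
qed

subsection \<open>Flat metrics with cone points\<close>

text \<open>The F of the overview. As \<open>a0\<close> is real, the exponential is |exp(2 i pi a0
  u)|.\<close>

definition T_abs :: "complex \<Rightarrow> nat \<Rightarrow> (nat \<Rightarrow> real) \<Rightarrow> (nat \<Rightarrow> complex) \<Rightarrow> complex \<Rightarrow> real" where
  "T_abs \<tau> n \<alpha> z u = exp (- 2 * pi * a0 \<tau> n \<alpha> z * Im u) *
     (\<Prod>i=1..n. cmod (theta (u - z i) \<tau>) powr \<alpha> i)"

text \<open>For real \<alpha>, |exp(\<alpha> L)| = exp(\<alpha> Re L) = |exp L|^\<alpha>, so the
  choice of the logarithms does not show in the modulus.\<close>

lemma T_branch_norm:
  assumes "T_branch \<tau> n \<alpha> z U T" "u \<in> U"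
  shows "cmod (T u) = T_abs \<tau> n \<alpha> z u"
proof -
  from assms obtain L where L: "\<And>i. i \<in> {1..n} \<Longrightarrow> exp (L i u) = theta (u - z i) \<tau>"
    and T: "T u = exp (2 * \<i> * pi * a0 \<tau> n \<alpha> z * u) * (\<Prod>i=1..n. exp (of_real (\<alpha> i) * L i u))"
    unfolding T_branch_def by blast
  have "cmod (exp (of_real (\<alpha> i) * L i u)) = cmod (theta (u - z i) \<tau>) powr \<alpha> i" if "i \<in> {1..n}" for i
    unfolding L[OF that, symmetric] by (simp add: powr_def)
  then have "cmod (\<Prod>i=1..n. exp (of_real (\<alpha> i) * L i u)) = (\<Prod>i=1..n. cmod (theta (u - z i) \<tau>) powr \<alpha> i)"
    unfolding prod_norm[symmetric] by (intro prod.cong refl)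
  then show ?thesis
    unfolding T T_abs_def norm_mult by simp
qed

lemma T_abs_pos:
  assumes "Im \<tau> > 0" "u \<in> punctured \<tau> n z"
  shows "T_abs \<tau> n \<alpha> z u > 0"
  unfolding T_abs_def using assms theta_eq_0_iff[OF assms(1)]
  by (intro mult_pos_pos prod_pos) (auto simp: punctured_iff)

text \<open>Under u + \<tau> the logarithm of |\<theta>(u - z_i)| grows by pi Im \<tau> + 2 pi Im (u
  - z_i). Weighted by \<alpha>_i and summed, the part independent of i cancels because the weights
  add up to 0, and -2 pi times the sum of \<alpha>_i Im z_i is left. The value of \<open>a0\<close>
  makes the exponential factor grow by the opposite amount; being real, it does not disturb the
  shift by 1.\<close>

lemma T_abs_periodic:
  assumes \<tau>: "Im \<tau> > 0" and \<alpha>: "(\<Sum>i=1..n. \<alpha> i) = 0" and l: "l \<in> lattice \<tau>"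
  shows "T_abs \<tau> n \<alpha> z (u + l) = T_abs \<tau> n \<alpha> z u"
proof (rule lattice_periodic[OF _ _ l])
  fix u
  have "theta (u + 1 - z i) \<tau> = - theta (u - z i) \<tau>" for i
    using theta_add_1[OF \<tau>, of "u - z i"] by (simp add: algebra_simps)
  then show "T_abs \<tau> n \<alpha> z (u + 1) = T_abs \<tau> n \<alpha> z u"
    unfolding T_abs_def by simp
next
  fix u
  let ?s = "\<lambda>i. pi * Im \<tau> + 2 * pi * Im (u - z i)"
  let ?S = "\<Sum>i=1..n. \<alpha> i * Im (z i)"
  have "cmod (theta (u + \<tau> - z i) \<tau>) powr \<alpha> i = exp (\<alpha> i * ?s i) * cmod (theta (u - z i) \<tau>) powr \<alpha> i" for i
  proof -
    have "theta (u + \<tau> - z i) \<tau> = - exp (- \<i> * pi * \<tau> - 2 * \<i> * pi * (u - z i)) * theta (u - z i) \<tau>"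
      using theta_add_tau[of "u - z i"] by (simp add: algebra_simps)
    moreover have "Re (- \<i> * pi * \<tau> - 2 * \<i> * pi * (u - z i)) = ?s i"
      by simp
    ultimately have "cmod (theta (u + \<tau> - z i) \<tau>) = exp (?s i) * cmod (theta (u - z i) \<tau>)"
      by (simp only: norm_mult norm_minus_cancel norm_exp_eq_Re)
    then show ?thesis
      by (simp add: powr_mult powr_def[of "exp _"])
  qed
  then have "(\<Prod>i=1..n. cmod (theta (u + \<tau> - z i) \<tau>) powr \<alpha> i) =
      exp (\<Sum>i=1..n. \<alpha> i * ?s i) * (\<Prod>i=1..n. cmod (theta (u - z i) \<tau>) powr \<alpha> i)"
    by (simp add: prod.distrib exp_sum)
  moreover have "(\<Sum>i=1..n. \<alpha> i * ?s i) = - 2 * pi * ?S"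
  proof -
    have "(\<Sum>i=1..n. \<alpha> i * ?s i) = (\<Sum>i=1..n. (pi * Im \<tau> + 2 * pi * Im u) * \<alpha> i - 2 * pi * (\<alpha> i * Im (z i)))"
      by (intro sum.cong) (auto simp: algebra_simps)
    also have "\<dots> = (pi * Im \<tau> + 2 * pi * Im u) * (\<Sum>i=1..n. \<alpha> i) - 2 * pi * ?S"
      unfolding sum_subtractf sum_distrib_left[symmetric] ..
    finally show ?thesis
      using \<alpha> by simp
  qed
  moreover have "- 2 * pi * a0 \<tau> n \<alpha> z * Im (u + \<tau>) = 2 * pi * ?S + - 2 * pi * a0 \<tau> n \<alpha> z * Im u"
    using \<tau> unfolding a0_def by (simp add: field_simps)
  ultimately show "T_abs \<tau> n \<alpha> z (u + \<tau>) = T_abs \<tau> n \<alpha> z u"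
    unfolding T_abs_def by (simp only: exp_add) (simp add: exp_minus)
qed

text \<open>Regular points and cone points in one statement: the powers of |u - p| that belong to
  the z_i equal to p are kept apart, and everything else goes into the zero-free h. At a regular p
  no power remains and h is a branch of T. Among the translates of a cone point, the assumption on p
  admits only the chosen z_i.\<close>

lemma T_local:
  assumes \<tau>: "Im \<tau> > 0" and p: "\<And>i. i \<in> {1..n} \<Longrightarrow> p = z i \<or> p - z i \<notin> lattice \<tau>"
  obtains \<epsilon> h where "\<epsilon> > 0" "h holomorphic_on ball p \<epsilon>" "\<And>u. h u \<noteq> 0"
    "ball p \<epsilon> - {p} \<subseteq> punctured \<tau> n z"
    "\<And>u. u \<in> ball p \<epsilon> \<Longrightarrow> T_abs \<tau> n \<alpha> z u =
       (\<Prod>i=1..n. if p = z i then cmod (u - p) powr \<alpha> i else 1) * cmod (h u)"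
    "p \<in> punctured \<tau> n z \<Longrightarrow> T_branch \<tau> n \<alpha> z (ball p \<epsilon>) h"
proof -
  have "\<forall>i\<in>{1..n}. \<exists>\<epsilon> L. \<epsilon> > 0 \<and> L holomorphic_on ball p \<epsilon> \<and>
      (\<forall>u\<in>ball p \<epsilon>. theta (u - z i) \<tau> = (if p = z i then u - p else 1) * exp (L u))"
  proof
    fix i assume "i \<in> {1..n}"
    then have "p - z i = 0 \<or> p - z i \<notin> lattice \<tau>"
      using p by force
    then obtain \<epsilon> L where \<epsilon>: "\<epsilon> > 0" and L: "L holomorphic_on ball (p - z i) \<epsilon>"
      and th: "\<And>u. u \<in> ball (p - z i) \<epsilon> \<Longrightarrow> theta u \<tau> = (if p - z i = 0 then u else 1) * exp (L u)"
      using theta_local_log[OF \<tau>] by metis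
    have shift: "u - z i \<in> ball (p - z i) \<epsilon>" if "u \<in> ball p \<epsilon>" for u
      using that by (simp add: dist_norm)
    have "(\<lambda>u. L (u - z i)) holomorphic_on ball p \<epsilon>"
      by (rule holomorphic_on_compose_gen[OF _ L, of "\<lambda>u. u - z i", unfolded o_def])
        (auto intro!: holomorphic_intros shift)
    moreover have "\<forall>u\<in>ball p \<epsilon>. theta (u - z i) \<tau> = (if p = z i then u - p else 1) * exp (L (u - z i))"
      using th shift by auto
    ultimately show "\<exists>\<epsilon> L. \<epsilon> > 0 \<and> L holomorphic_on ball p \<epsilon> \<and>
      (\<forall>u\<in>ball p \<epsilon>. theta (u - z i) \<tau> = (if p = z i then u - p else 1) * exp (L u))"
      using \<epsilon> by blast
  qed
  then obtain e L where e: "\<And>i. i \<in> {1..n} \<Longrightarrow> e i > (0::real)"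
    and L: "\<And>i. i \<in> {1..n} \<Longrightarrow> L i holomorphic_on ball p (e i)"
    and th: "\<And>i u. i \<in> {1..n} \<Longrightarrow> u \<in> ball p (e i) \<Longrightarrow>
      theta (u - z i) \<tau> = (if p = z i then u - p else 1) * exp (L i u)"
    unfolding bchoice_iff by blast
  \<comment> \<open>The inserted 1 keeps the set non-empty when n = 0.\<close>
  define \<epsilon> where "\<epsilon> = Min (insert 1 (e ` {1..n}))"
  have \<epsilon>: "\<epsilon> > 0"
    unfolding \<epsilon>_def using e by (subst Min_gr_iff) auto
  have "\<epsilon> \<le> e i" if "i \<in> {1..n}" for i
    unfolding \<epsilon>_def using that by (intro Min_le) auto
  then have sub: "ball p \<epsilon> \<subseteq> ball p (e i)" if "i \<in> {1..n}" for i
    using that subset_ball by blast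
  note L' = holomorphic_on_subset[OF L sub]
  define h where "h u = exp (2 * \<i> * pi * a0 \<tau> n \<alpha> z * u) * (\<Prod>i=1..n. exp (of_real (\<alpha> i) * L i u))" for u
  \<comment> \<open>Read off from the local formula: its right-hand side is non-zero, so u - z_i is
    not a zero of \<theta>.\<close>
  have punct: "u \<in> punctured \<tau> n z" if "u \<in> ball p \<epsilon>" "u \<noteq> p \<or> p \<in> punctured \<tau> n z" for u
    unfolding punctured_iff
  proof
    fix i assume i: "i \<in> {1..n}"
    have "p \<noteq> z i" if "p \<in> punctured \<tau> n z"
      using that i lattice_0 unfolding punctured_iff by (metis diff_self)
    moreover have "u \<in> ball p (e i)"
      using sub[OF i] that(1) by blast
    ultimately have "theta (u - z i) \<tau> \<noteq> 0"
      using th[OF i] that(2) by auto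
    then show "u - z i \<notin> lattice \<tau>"
      by (simp add: theta_eq_0_iff[OF \<tau>])
  qed
  show thesis
  proof (rule that[OF \<epsilon>, of h])
    show "h holomorphic_on ball p \<epsilon>"
      unfolding h_def by (intro holomorphic_intros L')
    show "h u \<noteq> 0" for u
      unfolding h_def by simp
    show "ball p \<epsilon> - {p} \<subseteq> punctured \<tau> n z"
      using punct by blast
    show "T_abs \<tau> n \<alpha> z u = (\<Prod>i=1..n. if p = z i then cmod (u - p) powr \<alpha> i else 1) * cmod (h u)"
      if u: "u \<in> ball p \<epsilon>" for u
    proof -
      have "cmod (theta (u - z i) \<tau>) powr \<alpha> i =
          (if p = z i then cmod (u - p) powr \<alpha> i else 1) * cmod (exp (of_real (\<alpha> i) * L i u))"
        if i: "i \<in> {1..n}" for i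
      proof -
        have "cmod (theta (u - z i) \<tau>) = (if p = z i then cmod (u - p) else 1) * exp (Re (L i u))"
          using th[OF i, of u] sub[OF i] u by (auto simp: norm_mult)
        then show ?thesis
          by (simp add: powr_mult powr_def[of "exp _"])
      qed
      then have "(\<Prod>i=1..n. cmod (theta (u - z i) \<tau>) powr \<alpha> i) =
          (\<Prod>i=1..n. (if p = z i then cmod (u - p) powr \<alpha> i else 1) * cmod (exp (of_real (\<alpha> i) * L i u)))"
        by (intro prod.cong refl)
      also have "\<dots> = (\<Prod>i=1..n. if p = z i then cmod (u - p) powr \<alpha> i else 1) *
          cmod (\<Prod>i=1..n. exp (of_real (\<alpha> i) * L i u))"
        unfolding prod.distrib prod_norm ..
      finally show ?thesis
        unfolding T_abs_def h_def norm_mult by simp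
    qed
    show "T_branch \<tau> n \<alpha> z (ball p \<epsilon>) h" if p': "p \<in> punctured \<tau> n z"
      unfolding T_branch_def
    proof (intro conjI exI[of _ L] ballI)
      show "ball p \<epsilon> \<subseteq> punctured \<tau> n z"
        using punct p' by blast
      fix i assume i: "i \<in> {1..n}"
      show "L i holomorphic_on ball p \<epsilon>"
        by (rule L'[OF i i])
      fix u assume "u \<in> ball p \<epsilon>"
      moreover have "p \<noteq> z i"
        using p' i lattice_0 unfolding punctured_iff by (metis diff_self)
      ultimately show "exp (L i u) = theta (u - z i) \<tau>"
        using th[OF i, of u] sub[OF i] by auto
    qed (auto simp: h_def)
  qed
qed

section \<open>Holomorphic charts at a cone point\<close>

text \<open>Solved by comparing Taylor coefficients, \<open>k\<^sub>n = h\<^sub>n b / (b + n)\<close>.\<close>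
lemma euler_equation_solution:
  fixes h :: "complex \<Rightarrow> complex"
  assumes h: "h holomorphic_on ball p \<epsilon>" and b: "b > 0"
  obtains K where "K holomorphic_on ball p \<epsilon>" "\<And>u. u \<in> ball p \<epsilon> \<Longrightarrow>
    of_real b * K u + (u - p) * deriv K u = of_real b * h u"
proof -
  define a where "a n = (deriv ^^ n) h p / fact n" for n
  define c where "c n = of_real (b / (b + n)) * a n" for n
  have a_sums: "(\<lambda>n. a n * x ^ n) sums h (p + x)" if "cmod x < \<epsilon>" for x
    using holomorphic_power_series[OF h, of "p + x"] that unfolding a_def by (simp add: dist_norm)
  have c_summable: "summable (\<lambda>n. c n * x ^ n)" if x: "cmod x < \<epsilon>" for x
  proof (rule summable_comparison_test'[of _ 0])
    \<comment> \<open>Convergence at a radius r between |x| and \<epsilon> gives absolute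
      convergence at x, and the factors b / (b + n) \<le> 1 preserve it.\<close>
    from x obtain r where r: "cmod x < r" "r < \<epsilon>"
      using dense by blast
    have "summable (\<lambda>n. a n * of_real r ^ n)"
      using a_sums[of "of_real r"] r norm_ge_zero[of x] unfolding sums_iff by auto
    then show "summable (\<lambda>n. cmod (a n * x ^ n))"
      by (rule powser_insidea) (use r in auto)
    show "cmod (c n * x ^ n) \<le> cmod (a n * x ^ n)" for n
    proof -
      have "cmod (of_real (b / (b + n))) \<le> 1"
        unfolding norm_of_real using b by simp
      from mult_right_mono[OF this norm_ge_zero[of "a n * x ^ n"]] show ?thesis
        unfolding c_def by (simp only: norm_mult mult.assoc mult_1_left)
    qed
  qed
  define k where "k x = (\<Sum>n. c n * x ^ n)" for x
  have k_deriv: "(k has_field_derivative (\<Sum>n. diffs c n * x ^ n)) (at x)" if "cmod x < \<epsilon>" for x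
    unfolding k_def[abs_def] by (rule termdiffs_strong'[OF c_summable that])
  have K_deriv: "((\<lambda>u. k (u - p)) has_field_derivative (\<Sum>n. diffs c n * (u - p) ^ n)) (at u)"
    if "u \<in> ball p \<epsilon>" for u
  proof -
    have 1: "cmod (u - p) < \<epsilon>"
      using that by (simp add: dist_norm norm_minus_commute)
    have 2: "((\<lambda>u. u - p) has_field_derivative 1) (at u)"
      by (auto intro!: derivative_eq_intros)
    from DERIV_chain2[where f = k and g = "\<lambda>u. u - p", OF k_deriv[OF 1] 2] show ?thesis
      by simp
  qed
  show thesis
  proof (rule that[of "\<lambda>u. k (u - p)"])
    show "(\<lambda>u. k (u - p)) holomorphic_on ball p \<epsilon>"
      using K_deriv unfolding holomorphic_on_open[OF open_ball] by blast
    fix u assume u: "u \<in> ball p \<epsilon>"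
    define x where "x = u - p"
    have x: "cmod x < \<epsilon>"
      using u by (simp add: x_def dist_norm norm_minus_commute)
    have "(\<lambda>n. of_nat n * c n * x ^ (n - Suc 0)) sums (\<Sum>n. diffs c n * x ^ n)"
      by (intro diffs_equiv termdiff_converges[OF x] c_summable)
    \<comment> \<open>Multiplication by x restores the exponent n; at n = 0, where
      \<open>n - Suc 0\<close> is 0, the factor n kills the term.\<close>
    from sums_mult[OF this, of x]
    have 1: "(\<lambda>n. of_nat n * c n * x ^ n) sums (x * (\<Sum>n. diffs c n * x ^ n))"
    proof (rule sums_cong[THEN iffD1, rotated])
      show "x * (of_nat n * c n * x ^ (n - Suc 0)) = of_nat n * c n * x ^ n" for n
        by (cases n) auto
    qed
    have 2: "(\<lambda>n. of_real b * (c n * x ^ n)) sums (of_real b * k x)"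
      unfolding k_def by (intro sums_mult summable_sums c_summable x)
    have "of_real b * (c n * x ^ n) + of_nat n * c n * x ^ n = of_real b * (a n * x ^ n)" for n
    proof -
      have "of_real b + of_nat n \<noteq> (0::complex)"
        using b by (metis add_pos_nonneg of_nat_0_le_iff of_real_add of_real_eq_0_iff of_real_of_nat_eq less_irrefl)
      then have "(of_real b + of_nat n) * of_real (b / (b + n)) = (of_real b :: complex)"
        by simp
      moreover have "of_real b * (c n * x ^ n) + of_nat n * c n * x ^ n =
          ((of_real b + of_nat n) * of_real (b / (b + n))) * (a n * x ^ n)"
        by (simp only: c_def algebra_simps)
      ultimately show ?thesis
        by metis
    qed
    with sums_add[OF 2 1] have "(\<lambda>n. of_real b * (a n * x ^ n)) sums
        (of_real b * k x + x * (\<Sum>n. diffs c n * x ^ n))"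
      by simp
    moreover have "(\<lambda>n. of_real b * (a n * x ^ n)) sums (of_real b * h u)"
      using sums_mult[OF a_sums[OF x]] by (simp add: x_def)
    ultimately have "of_real b * k x + x * (\<Sum>n. diffs c n * x ^ n) = of_real b * h u"
      by (rule sums_unique2)
    then show "of_real b * k (u - p) + (u - p) * deriv (\<lambda>u. k (u - p)) u = of_real b * h u"
      using DERIV_imp_deriv[OF K_deriv[OF u]] by (simp add: x_def)
  qed
qed

text \<open>
  With \<open>b = \<beta> + 1\<close> and \<open>x = u - p\<close>, the chart is \<open>f = (b \<integral> x\<^sup>\<beta> h)\<^bsup>1/b\<^esup> = x K\<^bsup>1/b\<^esup>\<close>, where \<open>K\<close> solves
  the differential equation \<open>b K + x K' = b h\<close>.
\<close>
lemma cone_chart: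
  fixes h :: "complex \<Rightarrow> complex"
  assumes h: "h holomorphic_on ball p \<epsilon>" and hp: "h p \<noteq> 0" and \<epsilon>: "\<epsilon> > 0" and \<beta>: "\<beta> > -1"
  obtains \<delta> f where "\<delta> > 0" "ball p \<delta> \<subseteq> ball p \<epsilon>" "f holomorphic_on ball p \<delta>" "inj_on f (ball p \<delta>)" "f p = 0"
    "\<And>u. u \<in> ball p \<delta> \<Longrightarrow> cmod (f u) powr \<beta> * cmod (deriv f u) = cmod (u - p) powr \<beta> * cmod (h u)"
proof -
  define b where "b = \<beta> + 1"
  have b: "b > 0"
    using \<beta> by (simp add: b_def)
  obtain K where K: "K holomorphic_on ball p \<epsilon>"
    and ode: "\<And>u. u \<in> ball p \<epsilon> \<Longrightarrow> of_real b * K u + (u - p) * deriv K u = of_real b * h u"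
    using euler_equation_solution[OF h b] by metis
  have p: "p \<in> ball p \<epsilon>"
    using \<epsilon> by simp
  have "K p \<noteq> 0"
    using ode[OF p] hp b by auto
  from holomorphic_nonzero_log[OF K open_ball p this]
  obtain r \<Lambda> where r: "r > 0" "ball p r \<subseteq> ball p \<epsilon>" and \<Lambda>: "\<Lambda> holomorphic_on ball p r"
    and K\<Lambda>: "\<And>u. u \<in> ball p r \<Longrightarrow> K u = exp (\<Lambda> u)"
    by metis
  \<comment> \<open>The root of K is taken through a logarithm, available near p because the
    differential equation at u = p reads K p = h p.\<close>
  define f where "f u = (u - p) * exp (\<Lambda> u / of_real b)" for u
  have f_deriv: "(f has_field_derivative exp (\<Lambda> u / of_real b) * (1 + (u - p) * deriv \<Lambda> u / of_real b)) (at u)"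
    and K_deriv: "deriv K u = exp (\<Lambda> u) * deriv \<Lambda> u" if u: "u \<in> ball p r" for u
  proof -
    have \<Lambda>': "(\<Lambda> has_field_derivative deriv \<Lambda> u) (at u)"
      by (rule holomorphic_derivI[OF \<Lambda> open_ball u])
    then show "(f has_field_derivative exp (\<Lambda> u / of_real b) * (1 + (u - p) * deriv \<Lambda> u / of_real b)) (at u)"
      unfolding f_def using b by (auto intro!: derivative_eq_intros simp: field_simps)
    have "((\<lambda>u. exp (\<Lambda> u)) has_field_derivative exp (\<Lambda> u) * deriv \<Lambda> u) (at u)"
      using \<Lambda>' by (auto intro!: derivative_eq_intros)
    then have "(K has_field_derivative exp (\<Lambda> u) * deriv \<Lambda> u) (at u)"
      by (rule has_field_derivative_transform_within_open[OF _ open_ball u]) (simp add: K\<Lambda>)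
    then show "deriv K u = exp (\<Lambda> u) * deriv \<Lambda> u"
      by (rule DERIV_imp_deriv)
  qed
  have f_hol: "f holomorphic_on ball p r"
    unfolding f_def using b by (intro holomorphic_intros \<Lambda>) auto
  have pr: "p \<in> ball p r"
    using r by simp
  have "deriv f p \<noteq> 0"
    using DERIV_imp_deriv[OF f_deriv[OF pr]] by simp
  then obtain \<delta> where \<delta>: "\<delta> > 0" "ball p \<delta> \<subseteq> ball p r" "inj_on f (ball p \<delta>)"
    using has_complex_derivative_locally_injective[OF f_hol pr open_ball] by metis
  show thesis
  proof (rule that[OF \<delta>(1) _ _ \<delta>(3)])
    show "ball p \<delta> \<subseteq> ball p \<epsilon>" "f holomorphic_on ball p \<delta>" "f p = 0"
      using \<delta>(2) r(2) holomorphic_on_subset[OF f_hol] by (auto simp: f_def)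
    fix u assume "u \<in> ball p \<delta>"
    then have u: "u \<in> ball p r" "u \<in> ball p \<epsilon>"
      using \<delta>(2) r(2) by blast+
    have "of_real b * h u = of_real b * (exp (\<Lambda> u) * (1 + (u - p) * deriv \<Lambda> u / of_real b))"
      using ode[OF u(2)] K_deriv[OF u(1)] K\<Lambda>[OF u(1)] b by (simp add: field_simps)
    then have h_eq: "h u = exp (\<Lambda> u) * (1 + (u - p) * deriv \<Lambda> u / of_real b)"
      using b by simp
    \<comment> \<open>The exponents \<beta> / b and 1 / b add up to 1, which is why the root has
      order b.\<close>
    have "cmod (exp (\<Lambda> u / of_real b)) powr \<beta> * cmod (exp (\<Lambda> u / of_real b)) = cmod (exp (\<Lambda> u))"
    proof -
      have "\<beta> * (Re (\<Lambda> u) / b) + Re (\<Lambda> u) / b = Re (\<Lambda> u)"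
      proof -
        have "\<beta> * (Re (\<Lambda> u) / b) + Re (\<Lambda> u) / b = b * (Re (\<Lambda> u) / b)"
          by (simp only: b_def distrib_right mult_1_left)
        then show ?thesis
          using b by simp
      qed
      then show ?thesis
        by (simp add: powr_def exp_add[symmetric])
    qed
    then show "cmod (f u) powr \<beta> * cmod (deriv f u) = cmod (u - p) powr \<beta> * cmod (h u)"
      unfolding DERIV_imp_deriv[OF f_deriv[OF u(1)]] h_eq f_def norm_mult
      by (simp add: powr_mult mult.assoc[symmetric])
  qed
qed

text \<open>The derivative of the isometry \<phi> sends 1 and i to orthogonal vectors of equal
  length, so at each point \<phi>'(i) is \<phi>'(1) times i or -i. By continuity one sign holds on
  the whole ball, where \<phi> or its conjugate is then holomorphic with a derivative of modulus
  |\<phi>'(1)|.\<close>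

lemma conformal_flat_local:
  assumes conf: "conformal_on S m" and flat: "flat_on S m" and p: "p \<in> S"
  obtains \<epsilon> g where "\<epsilon> > 0" "ball p \<epsilon> \<subseteq> S" "g holomorphic_on ball p \<epsilon>"
    "\<And>u. u \<in> ball p \<epsilon> \<Longrightarrow> sqrt (m u 1 1) = cmod (g u)"
proof -
  obtain U \<phi> \<phi>' where U: "open U" "p \<in> U" "U \<subseteq> S"
    and \<phi>: "\<forall>u\<in>U. (\<phi> has_derivative \<phi>' u) (at u)"
    and cont: "\<forall>v. continuous_on U (\<lambda>u. \<phi>' u v)"
    and m: "\<forall>u\<in>U. \<forall>v w. m u v w = \<phi>' u v \<bullet> (\<phi>' u w :: complex)"
    using bspec[OF flat[unfolded flat_on_def] p] by (elim exE conjE) (rule that; assumption)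
  obtain \<epsilon> where \<epsilon>: "\<epsilon> > 0" "ball p \<epsilon> \<subseteq> U"
    using U(1,2) by (metis open_contains_ball)
  define a where "a u = \<phi>' u 1" for u
  define j where "j u = \<phi>' u \<i> / a u" for u
  have a_nz: "a u \<noteq> 0" and j: "j u = \<i> \<or> j u = - \<i>" if u: "u \<in> ball p \<epsilon>" for u
  proof -
    have uU: "u \<in> U"
      using u \<epsilon> by blast
    then obtain s where s: "s > 0" "\<And>v w. m u v w = s * (v \<bullet> w)"
      using conf U(3) unfolding conformal_on_def by (metis subsetD)
    have 1: "a u \<bullet> a u = s" "\<phi>' u \<i> \<bullet> \<phi>' u \<i> = s" "a u \<bullet> \<phi>' u \<i> = 0"
      using m[rule_format, OF uU, of 1 1] m[rule_format, OF uU, of \<i> \<i>] m[rule_format, OF uU, of 1 \<i>] unfolding s(2) a_def by simp_all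
    then show nz: "a u \<noteq> 0"
      using s(1) by auto
    have "\<phi>' u \<i> = j u * a u"
      using nz by (simp add: j_def)
    with 1 have "a u \<bullet> (j u * a u) = 0" "(j u * a u) \<bullet> (j u * a u) = a u \<bullet> a u"
      by simp_all
    \<comment> \<open>Orthogonality becomes Re j = 0, and equality of lengths becomes |j| =
      1.\<close>
    moreover have "x \<bullet> (y * x) = Re y * (x \<bullet> x)" "(y * x) \<bullet> (y * x) = (cmod y)\<^sup>2 * (x \<bullet> x)" for x y :: complex
      unfolding cmod_power2 by (simp_all add: inner_complex_def power2_eq_square algebra_simps)
    ultimately have "Re (j u) = 0" "(cmod (j u))\<^sup>2 = 1"
      using nz by simp_all
    then show "j u = \<i> \<or> j u = - \<i>"
      by (auto simp: cmod_power2 complex_eq_iff power2_eq_1_iff)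
  qed
  have "j constant_on ball p \<epsilon>"
  proof (rule continuous_finite_range_constant[OF connected_ball])
    show "continuous_on (ball p \<epsilon>) j"
      unfolding j_def a_def using a_nz[unfolded a_def]
      by (intro continuous_intros continuous_on_subset[OF cont[rule_format] \<epsilon>(2)]) auto
    have "j ` ball p \<epsilon> \<subseteq> {\<i>, - \<i>}"
      using j by blast
    then show "finite (j ` ball p \<epsilon>)"
      by (rule finite_subset) simp
  qed
  then obtain j0 where j0: "\<And>u. u \<in> ball p \<epsilon> \<Longrightarrow> j u = j0"
    unfolding constant_on_def by blast
  have \<phi>_at: "(\<phi> has_derivative \<phi>' u) (at u)" if "u \<in> ball p \<epsilon>" for u
    using \<phi> that \<epsilon>(2) by blast
  have \<phi>'_eq: "\<phi>' u v = of_real (Re v) * a u + of_real (Im v) * (j0 * a u)" if u: "u \<in> ball p \<epsilon>" for u v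
  proof -
    interpret bounded_linear "\<phi>' u"
      by (rule has_derivative_bounded_linear[OF \<phi>_at[OF u]])
    have "\<phi>' u \<i> = j0 * a u"
      using a_nz[OF u] j0[OF u] by (simp add: j_def divide_eq_eq)
    moreover have "v = Re v *\<^sub>R 1 + Im v *\<^sub>R \<i>"
      by (simp add: complex_eq_iff)
    then have "\<phi>' u v = Re v *\<^sub>R \<phi>' u 1 + Im v *\<^sub>R \<phi>' u \<i>"
      by (metis add scaleR)
    ultimately show ?thesis
      by (simp add: a_def scaleR_conv_of_real)
  qed
  have sqrt_m: "sqrt (m u 1 1) = cmod (a u)" if "u \<in> ball p \<epsilon>" for u
    using m that \<epsilon>(2) unfolding a_def by (auto simp: norm_eq_sqrt_inner)
  have "j0 = \<i> \<or> j0 = - \<i>"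
    using j[of p] j0[of p] \<epsilon>(1) by auto
  then obtain \<psi> g where \<psi>: "\<And>u. u \<in> ball p \<epsilon> \<Longrightarrow> (\<psi> has_field_derivative g u) (at u)"
    and g: "\<And>u. cmod (g u) = cmod (a u)"
  proof
    assume j0: "j0 = \<i>"
    have "(\<phi> has_field_derivative a u) (at u)" if "u \<in> ball p \<epsilon>" for u
    proof -
      have "\<phi>' u = (*) (a u)"
      proof
        fix v
        have "\<phi>' u v = (of_real (Re v) + \<i> * of_real (Im v)) * a u"
          unfolding \<phi>'_eq[OF that] j0 by (simp add: algebra_simps)
        then show "\<phi>' u v = a u * v"
          by (simp add: complex_eq[symmetric])
      qed
      then show ?thesis
        using \<phi>_at[OF that] by (simp add: has_field_derivative_def)
    qed
    then show thesis
      using that by blast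
  next
    assume j0: "j0 = - \<i>"
    have "((\<lambda>u. cnj (\<phi> u)) has_field_derivative cnj (a u)) (at u)" if "u \<in> ball p \<epsilon>" for u
    proof -
      have "(\<lambda>v. cnj (\<phi>' u v)) = (*) (cnj (a u))"
      proof
        fix v
        have "cnj (\<phi>' u v) = (of_real (Re v) + \<i> * of_real (Im v)) * cnj (a u)"
          unfolding \<phi>'_eq[OF that] j0 by (simp add: algebra_simps)
        then show "cnj (\<phi>' u v) = cnj (a u) * v"
          by (simp add: complex_eq[symmetric])
      qed
      moreover have "((\<lambda>u. cnj (\<phi> u)) has_derivative (\<lambda>v. cnj (\<phi>' u v))) (at u)"
        by (rule has_derivative_cnj[OF \<phi>_at[OF that]])
      ultimately show ?thesis
        by (simp add: has_field_derivative_def)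
    qed
    then show thesis
      using that[of "\<lambda>u. cnj (\<phi> u)" "\<lambda>u. cnj (a u)"] by simp
  qed
  \<comment> \<open>g is holomorphic as the derivative of a holomorphic function, although \<phi>
    was only assumed continuously differentiable.\<close>
  have "\<psi> holomorphic_on ball p \<epsilon>"
    using \<psi> unfolding holomorphic_on_open[OF open_ball] by blast
  then have "deriv \<psi> holomorphic_on ball p \<epsilon>"
    by (rule holomorphic_deriv) simp
  then have "g holomorphic_on ball p \<epsilon>"
    by (rule holomorphic_transform) (use \<psi> DERIV_imp_deriv in blast)
  then show thesis
    using that[OF \<epsilon>(1)] \<epsilon>(2) U(3) sqrt_m g by auto
qed

section \<open>The form |T du|^2 at regular points and at cone points\<close>

lemma abs_sq_form_eq: "abs_sq_form t v w = (cmod t)\<^sup>2 * (v \<bullet> w)"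
  unfolding abs_sq_form_def cmod_power2
  by (simp add: inner_complex_def power2_eq_square algebra_simps)

lemma T_branch_exists:
  assumes \<tau>: "Im \<tau> > 0" and p: "p \<in> punctured \<tau> n z"
  obtains \<epsilon> T where "\<epsilon> > 0" "ball p \<epsilon> \<subseteq> punctured \<tau> n z" "T_branch \<tau> n \<alpha> z (ball p \<epsilon>) T"
    "T holomorphic_on ball p \<epsilon>" "\<And>u. u \<in> ball p \<epsilon> \<Longrightarrow> T u \<noteq> 0"
    "\<And>u. u \<in> ball p \<epsilon> \<Longrightarrow> cmod (T u) = T_abs \<tau> n \<alpha> z u"
proof -
  have "p = z i \<or> p - z i \<notin> lattice \<tau>" if "i \<in> {1..n}" for i
    using p that unfolding punctured_iff by blast
  then obtain \<epsilon> T where "\<epsilon> > 0" "T holomorphic_on ball p \<epsilon>" "\<And>u. T u \<noteq> 0"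
    and br: "T_branch \<tau> n \<alpha> z (ball p \<epsilon>) T"
    by (rule T_local[where n = n and z = z and \<alpha> = \<alpha>, OF \<tau>]) (assumption, rule that, assumption+, simp add: p)
  moreover have "ball p \<epsilon> \<subseteq> punctured \<tau> n z"
    using br unfolding T_branch_def by (elim conjE)
  ultimately show thesis
    using that[OF _ _ br] T_branch_norm[OF br] by simp
qed

text \<open>Since the classes are distinct, only the factor i = j contributes a power in
  \<open>T_local\<close>.\<close>

lemma T_local_cone:
  assumes \<tau>: "Im \<tau> > 0" and inj: "inj_on (\<lambda>i. torus_point \<tau> (z i)) {1..n}" and j: "j \<in> {1..n}"
  obtains \<epsilon> h where "\<epsilon> > 0" "h holomorphic_on ball (z j) \<epsilon>" "\<And>u. h u \<noteq> 0"
    "ball (z j) \<epsilon> - {z j} \<subseteq> punctured \<tau> n z"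
    "\<And>u. u \<in> ball (z j) \<epsilon> \<Longrightarrow> T_abs \<tau> n \<alpha> z u = cmod (u - z j) powr \<alpha> j * cmod (h u)"
proof -
  have eq: "i = j" if "i \<in> {1..n}" "z j - z i \<in> lattice \<tau>" for i
    using inj_onD[OF inj, of j i] that j by (simp add: torus_point_eq_iff)
  have "z j = z i \<or> z j - z i \<notin> lattice \<tau>" if "i \<in> {1..n}" for i
    using eq[OF that] by blast
  then obtain \<epsilon> h where \<epsilon>: "\<epsilon> > 0" "h holomorphic_on ball (z j) \<epsilon>" "\<And>u. h u \<noteq> 0"
    "ball (z j) \<epsilon> - {z j} \<subseteq> punctured \<tau> n z"
    and T: "\<And>u. u \<in> ball (z j) \<epsilon> \<Longrightarrow> T_abs \<tau> n \<alpha> z u =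
       (\<Prod>i=1..n. if z j = z i then cmod (u - z j) powr \<alpha> i else 1) * cmod (h u)"
    by (rule T_local[where n = n and z = z and \<alpha> = \<alpha>, OF \<tau>]) (assumption, rule that)
  have "z j = z i \<longleftrightarrow> j = i" if "i \<in> {1..n}" for i
    using eq[OF that] lattice_0 by (metis diff_self)
  then have "(\<Prod>i=1..n. if z j = z i then cmod (u - z j) powr \<alpha> i else 1) =
      (\<Prod>i=1..n. if j = i then cmod (u - z j) powr \<alpha> i else 1)" for u
    by (intro prod.cong refl) auto
  also have "\<dots> u = cmod (u - z j) powr \<alpha> j" for u
    using j by (subst prod.delta') auto
  finally show thesis
    using that[OF \<epsilon>] T by simp
qed

text \<open>Trades the branches for the single-valued \<open>T_abs\<close>. The forward direction
  rests on the existence of a branch around every point of the punctured plane.\<close>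

lemma T_metric_iff:
  assumes \<tau>: "Im \<tau> > 0"
  shows "(\<forall>U T. T_branch \<tau> n \<alpha> z U T \<longrightarrow> (\<forall>u\<in>U. \<forall>v w. m u v w = c * abs_sq_form (T u) v w)) \<longleftrightarrow>
    (\<forall>u\<in>punctured \<tau> n z. \<forall>v w. m u v w = c * ((T_abs \<tau> n \<alpha> z u)\<^sup>2 * (v \<bullet> w)))"
    (is "?L \<longleftrightarrow> ?R")
proof
  assume L: ?L
  show ?R
  proof (intro ballI allI)
    fix u v w assume "u \<in> punctured \<tau> n z"
    then obtain \<epsilon> T where "\<epsilon> > 0" and br: "T_branch \<tau> n \<alpha> z (ball u \<epsilon>) T"
      using T_branch_exists[OF \<tau>] by metis
    then have u: "u \<in> ball u \<epsilon>"
      by simp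
    show "m u v w = c * ((T_abs \<tau> n \<alpha> z u)\<^sup>2 * (v \<bullet> w))"
      using L[rule_format, OF br u] by (simp add: abs_sq_form_eq T_branch_norm[OF br u])
  qed
next
  assume R: ?R
  show ?L
  proof (intro allI impI ballI)
    fix U T u v w assume br: "T_branch \<tau> n \<alpha> z U T" and u: "u \<in> U"
    then have "u \<in> punctured \<tau> n z"
      unfolding T_branch_def by blast
    then show "m u v w = c * abs_sq_form (T u) v w"
      using R by (simp add: abs_sq_form_eq T_branch_norm[OF br u])
  qed
qed

text \<open>A primitive of sqrt(c) T is a developing map: its derivative has the right modulus, and
  it is injective near each point because T has no zeros there.\<close>

lemma T_metric_flat:
  assumes \<tau>: "Im \<tau> > 0" and c: "c > 0"
    and m: "\<And>u v w. u \<in> punctured \<tau> n z \<Longrightarrow> m u v w = c * ((T_abs \<tau> n \<alpha> z u)\<^sup>2 * (v \<bullet> w))"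
  shows "flat_on (punctured \<tau> n z) m"
  unfolding flat_on_def
proof
  fix p assume "p \<in> punctured \<tau> n z"
  then obtain \<epsilon> T where \<epsilon>: "\<epsilon> > 0" "ball p \<epsilon> \<subseteq> punctured \<tau> n z"
    and T: "T holomorphic_on ball p \<epsilon>" "\<And>u. u \<in> ball p \<epsilon> \<Longrightarrow> T u \<noteq> 0"
    and T_norm: "\<And>u. u \<in> ball p \<epsilon> \<Longrightarrow> cmod (T u) = T_abs \<tau> n \<alpha> z u"
    using T_branch_exists[OF \<tau>] by metis
  define f where "f u = of_real (sqrt c) * T u" for u
  have f_hol: "f holomorphic_on ball p \<epsilon>"
    unfolding f_def by (intro holomorphic_intros T)
  then obtain \<phi> where "\<And>u. u \<in> ball p \<epsilon> \<Longrightarrow> (\<phi> has_field_derivative f u) (at u within ball p \<epsilon>)"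
    using holomorphic_convex_primitive'[OF convex_ball open_ball] by metis
  then have \<phi>: "(\<phi> has_field_derivative f u) (at u)" if "u \<in> ball p \<epsilon>" for u
    using that at_within_open[OF that open_ball] by metis
  have \<phi>_hol: "\<phi> holomorphic_on ball p \<epsilon>"
    using \<phi> unfolding holomorphic_on_open[OF open_ball] by blast
  have p: "p \<in> ball p \<epsilon>"
    using \<epsilon> by simp
  have "deriv \<phi> p \<noteq> 0"
    using DERIV_imp_deriv[OF \<phi>[OF p]] T(2)[OF p] c by (simp add: f_def)
  then obtain r where r: "r > 0" "ball p r \<subseteq> ball p \<epsilon>" "inj_on \<phi> (ball p r)"
    using has_complex_derivative_locally_injective[OF \<phi>_hol p open_ball] by metis
  show "\<exists>U \<phi> \<phi>'. open U \<and> p \<in> U \<and> U \<subseteq> punctured \<tau> n z \<and> inj_on \<phi> U \<and>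
     (\<forall>u\<in>U. (\<phi> has_derivative \<phi>' u) (at u)) \<and>
     (\<forall>v. continuous_on U (\<lambda>u. \<phi>' u v)) \<and>
     (\<forall>u\<in>U. \<forall>v w. m u v w = \<phi>' u v \<bullet> (\<phi>' u w :: complex))"
  proof (intro exI conjI ballI allI)
    show "open (ball p r)" "p \<in> ball p r" "ball p r \<subseteq> punctured \<tau> n z" "inj_on \<phi> (ball p r)"
      using r \<epsilon>(2) by auto
    show "(\<phi> has_derivative (*) (f u)) (at u)" if "u \<in> ball p r" for u
      using \<phi>[of u] that r(2) unfolding has_field_derivative_def by blast
    show "continuous_on (ball p r) (\<lambda>u. f u * v)" for v
      using continuous_on_subset[OF holomorphic_on_imp_continuous_on[OF f_hol] r(2)]
      by (intro continuous_intros)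
    show "m u v w = (f u * v) \<bullet> (f u * w)" if "u \<in> ball p r" for u v w
    proof -
      have "u \<in> ball p \<epsilon>" "u \<in> punctured \<tau> n z"
        using that r(2) \<epsilon>(2) by blast+
      moreover from this have "(cmod (f u))\<^sup>2 = c * (T_abs \<tau> n \<alpha> z u)\<^sup>2"
        using c T_norm by (simp add: f_def norm_mult power_mult_distrib)
      ultimately show ?thesis
        using abs_sq_form_eq[of "f u" v w] m by (simp add: abs_sq_form_def)
    qed
  qed
qed

text \<open>The constant is absorbed into the chart: \<open>cone_chart\<close> is applied to sqrt(c)
  h, so that the conical model appears without a factor.\<close>

lemma T_metric_conical:
  assumes \<tau>: "Im \<tau> > 0" and c: "c > 0" and inj: "inj_on (\<lambda>i. torus_point \<tau> (z i)) {1..n}"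
    and m: "\<And>u v w. u \<in> punctured \<tau> n z \<Longrightarrow> m u v w = c * ((T_abs \<tau> n \<alpha> z u)\<^sup>2 * (v \<bullet> w))"
    and i: "i \<in> {1..n}" and \<alpha>: "\<alpha> i > -1"
  shows "conical_at (z i) (\<alpha> i) m"
proof -
  obtain \<epsilon> h where \<epsilon>: "\<epsilon> > 0" and h: "h holomorphic_on ball (z i) \<epsilon>" "\<And>u. h u \<noteq> 0"
    and sub: "ball (z i) \<epsilon> - {z i} \<subseteq> punctured \<tau> n z"
    and T: "\<And>u. u \<in> ball (z i) \<epsilon> \<Longrightarrow> T_abs \<tau> n \<alpha> z u = cmod (u - z i) powr \<alpha> i * cmod (h u)"
    using T_local_cone[OF \<tau> inj i] by metis
  have "(\<lambda>u. of_real (sqrt c) * h u) holomorphic_on ball (z i) \<epsilon>" "of_real (sqrt c) * h (z i) \<noteq> 0"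
    using h c by (auto intro!: holomorphic_intros)
  from cone_chart[OF this \<epsilon> \<alpha>]
  obtain \<delta> f where \<delta>: "\<delta> > 0" "ball (z i) \<delta> \<subseteq> ball (z i) \<epsilon>" "f holomorphic_on ball (z i) \<delta>"
    "inj_on f (ball (z i) \<delta>)" "f (z i) = 0"
    and f: "\<And>u. u \<in> ball (z i) \<delta> \<Longrightarrow> cmod (f u) powr \<alpha> i * cmod (deriv f u) =
      cmod (u - z i) powr \<alpha> i * cmod (of_real (sqrt c) * h u)"
    by metis
  show ?thesis
    unfolding conical_at_def
  proof (intro exI conjI ballI allI)
    show "open (ball (z i) \<delta>)" "z i \<in> ball (z i) \<delta>" "f holomorphic_on ball (z i) \<delta>"
      "inj_on f (ball (z i) \<delta>)" "f (z i) = 0"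
      using \<delta> by auto
    fix u v w assume u: "u \<in> ball (z i) \<delta> - {z i}"
    then have uS: "u \<in> punctured \<tau> n z"
      using sub \<delta>(2) by blast
    have "u \<in> ball (z i) \<epsilon>"
      using u \<delta>(2) by blast
    then have "sqrt c * T_abs \<tau> n \<alpha> z u = cmod (f u) powr \<alpha> i * cmod (deriv f u)"
      using f[of u] T[of u] u c by (simp add: norm_mult)
    then have "(sqrt c * T_abs \<tau> n \<alpha> z u)\<^sup>2 = (cmod (f u) powr \<alpha> i)\<^sup>2 * (cmod (deriv f u))\<^sup>2"
      by (simp add: power_mult_distrib)
    then have "c * (T_abs \<tau> n \<alpha> z u)\<^sup>2 = (cmod (f u) powr \<alpha> i)\<^sup>2 * (cmod (deriv f u))\<^sup>2"
      using c by (simp add: power_mult_distrib)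
    then show "m u v w = (cmod (f u) powr \<alpha> i)\<^sup>2 * abs_sq_form (deriv f u) v w"
      unfolding m[OF uS] abs_sq_form_eq by (simp only: mult.assoc[symmetric])
  qed
qed

text \<open>An injective f has a non-zero derivative at p, so f = (u - p) exp L nearby, and
  |f|^\<beta> |f'| is |u - p|^\<beta> times the modulus of exp(\<beta> L) f'.\<close>

lemma conical_local:
  assumes "conical_at p \<beta> m"
  obtains \<epsilon> g where "\<epsilon> > 0" "g holomorphic_on ball p \<epsilon>"
    "\<And>u. u \<in> ball p \<epsilon> - {p} \<Longrightarrow> sqrt (m u 1 1) = cmod (u - p) powr \<beta> * cmod (g u)"
proof -
  obtain U f where U: "open U" "p \<in> U" and f: "f holomorphic_on U" "inj_on f U" "f p = 0"
    and m: "\<forall>u\<in>U - {p}. \<forall>v w. m u v w = (cmod (f u) powr \<beta>)\<^sup>2 * abs_sq_form (deriv f u) v w"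
    using assms[unfolded conical_at_def] by (elim exE conjE) (rule that; assumption)
  obtain k where k: "k holomorphic_on U" "k p = deriv f p" "\<And>u. u \<in> U \<Longrightarrow> f u = (u - p) * k u"
    using divide_zero_holomorphic[OF f(1) U f(3)] by metis
  have "k p \<noteq> 0"
    using holomorphic_injective_imp_regular[OF f(1) U(1) f(2) U(2)] k(2) by simp
  from holomorphic_nonzero_log[OF k(1) U this]
  obtain \<epsilon> L where \<epsilon>: "\<epsilon> > 0" "ball p \<epsilon> \<subseteq> U" and L: "L holomorphic_on ball p \<epsilon>"
    "\<And>u. u \<in> ball p \<epsilon> \<Longrightarrow> k u = exp (L u)"
    by metis
  define g where "g u = exp (of_real \<beta> * L u) * deriv f u" for u
  show thesis
  proof (rule that[OF \<epsilon>(1), of g])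
    show "g holomorphic_on ball p \<epsilon>"
      unfolding g_def
      by (intro holomorphic_intros L holomorphic_on_subset[OF holomorphic_deriv[OF f(1) U(1)] \<epsilon>(2)])
    fix u assume u: "u \<in> ball p \<epsilon> - {p}"
    then have uU: "u \<in> U - {p}"
      using \<epsilon>(2) by blast
    have "m u 1 1 = (cmod (f u) powr \<beta> * cmod (deriv f u))\<^sup>2"
      using m[rule_format, OF uU, of 1 1] by (simp add: abs_sq_form_eq power_mult_distrib)
    then have "sqrt (m u 1 1) = cmod (f u) powr \<beta> * cmod (deriv f u)"
      by simp
    also have "cmod (f u) = cmod (u - p) * exp (Re (L u))"
      using k(3)[of u] L(2)[of u] u uU by (simp add: norm_mult)
    also have "\<dots> powr \<beta> * cmod (deriv f u) = cmod (u - p) powr \<beta> * cmod (g u)"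
      by (simp add: powr_mult powr_def[of "exp _"] g_def norm_mult)
    finally show "sqrt (m u 1 1) = cmod (u - p) powr \<beta> * cmod (g u)" .
  qed
qed

lemma flat_cone_metric_ratio_constant:
  assumes \<tau>: "Im \<tau> > 0" and \<alpha>: "(\<Sum>i=1..n. \<alpha> i) = 0"
    and inj: "inj_on (\<lambda>i. torus_point \<tau> (z i)) {1..n}"
    and m: "flat_cone_metric \<tau> n \<alpha> z m"
  obtains c where "\<And>u. u \<in> punctured \<tau> n z \<Longrightarrow> sqrt (m u 1 1) / T_abs \<tau> n \<alpha> z u = c"
proof -
  let ?S = "punctured \<tau> n z"
  let ?q = "\<lambda>u. sqrt (m u 1 1) / T_abs \<tau> n \<alpha> z u"
  from m have inv: "lattice_invariant_on ?S \<tau> m" and conf: "conformal_on ?S m" and flat: "flat_on ?S m"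
    and con: "\<And>i. i \<in> {1..n} \<Longrightarrow> conical_at (z i) (\<alpha> i) m"
    unfolding flat_cone_metric_def by auto
  show thesis
  proof (rule torus_locally_modulus_constant[OF \<tau>, of ?S ?q])
    fix u l assume "u \<in> ?S" "l \<in> lattice \<tau>"
    then show "u + l \<in> ?S" "?q (u + l) = ?q u"
      using inv unfolding lattice_invariant_on_def by (auto simp: punctured_add T_abs_periodic[OF \<tau> \<alpha>])
  next
    fix p
    show "\<exists>l\<in>lattice \<tau>. \<exists>\<epsilon>>0. \<exists>g. g holomorphic_on ball (p + l) \<epsilon> \<and>
      ball (p + l) \<epsilon> - {p + l} \<subseteq> ?S \<and> (\<forall>u\<in>ball (p + l) \<epsilon> \<inter> ?S. ?q u = cmod (g u))"
    proof (cases "p \<in> ?S")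
      case True
      obtain \<epsilon>1 T where T: "\<epsilon>1 > 0" "T holomorphic_on ball p \<epsilon>1" "\<And>u. u \<in> ball p \<epsilon>1 \<Longrightarrow> T u \<noteq> 0"
        "\<And>u. u \<in> ball p \<epsilon>1 \<Longrightarrow> cmod (T u) = T_abs \<tau> n \<alpha> z u" "ball p \<epsilon>1 \<subseteq> ?S"
        using T_branch_exists[OF \<tau> True] by metis
      obtain \<epsilon>2 g where g: "\<epsilon>2 > 0" "g holomorphic_on ball p \<epsilon>2"
        "\<And>u. u \<in> ball p \<epsilon>2 \<Longrightarrow> sqrt (m u 1 1) = cmod (g u)"
        using conformal_flat_local[OF conf flat True] by metis
      define \<epsilon> where "\<epsilon> = min \<epsilon>1 \<epsilon>2"
      have \<epsilon>: "\<epsilon> > 0" "ball p \<epsilon> \<subseteq> ball p \<epsilon>1" "ball p \<epsilon> \<subseteq> ball p \<epsilon>2"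
        using T(1) g(1) by (auto simp: \<epsilon>_def)
      have "(\<lambda>u. g u / T u) holomorphic_on ball p \<epsilon>"
        using \<epsilon> T(3) by (intro holomorphic_intros holomorphic_on_subset[OF T(2)] holomorphic_on_subset[OF g(2)]) auto
      moreover have "\<forall>u\<in>ball p \<epsilon> \<inter> ?S. ?q u = cmod (g u / T u)"
        using g(3) T(4) \<epsilon>(2,3) by (auto simp: norm_divide subset_eq)
      moreover have "ball p \<epsilon> - {p} \<subseteq> ?S"
        using T(5) \<epsilon>(2) by blast
      ultimately show ?thesis
        using \<epsilon>(1) by (intro bexI[of _ 0] exI[of _ \<epsilon>] conjI exI[of _ "\<lambda>u. g u / T u"]) simp_all
    next
      case False
      \<comment> \<open>A point over a puncture is moved to the representative z_i, the place where
        the conical model is given.\<close>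
      then obtain i where i: "i \<in> {1..n}" and l: "p - z i \<in> lattice \<tau>"
        unfolding punctured_iff by blast
      obtain \<epsilon>1 h where h: "\<epsilon>1 > 0" "h holomorphic_on ball (z i) \<epsilon>1" "\<And>u. h u \<noteq> 0"
        "ball (z i) \<epsilon>1 - {z i} \<subseteq> ?S"
        "\<And>u. u \<in> ball (z i) \<epsilon>1 \<Longrightarrow> T_abs \<tau> n \<alpha> z u = cmod (u - z i) powr \<alpha> i * cmod (h u)"
        using T_local_cone[OF \<tau> inj i] by metis
      obtain \<epsilon>2 g where g: "\<epsilon>2 > 0" "g holomorphic_on ball (z i) \<epsilon>2"
        "\<And>u. u \<in> ball (z i) \<epsilon>2 - {z i} \<Longrightarrow> sqrt (m u 1 1) = cmod (u - z i) powr \<alpha> i * cmod (g u)"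
        using conical_local[OF con[OF i]] by metis
      define \<epsilon> where "\<epsilon> = min \<epsilon>1 \<epsilon>2"
      have \<epsilon>: "\<epsilon> > 0" "ball (z i) \<epsilon> \<subseteq> ball (z i) \<epsilon>1" "ball (z i) \<epsilon> \<subseteq> ball (z i) \<epsilon>2"
        using h(1) g(1) by (auto simp: \<epsilon>_def)
      \<comment> \<open>The powers of |u - z_i| in the metric and in \<open>T_abs\<close> have the
        same exponent and cancel; what remains is |g / h|, where h has no zeros.\<close>
      have "(\<lambda>u. g u / h u) holomorphic_on ball (z i) \<epsilon>"
        using \<epsilon> h(3) by (intro holomorphic_intros holomorphic_on_subset[OF h(2)] holomorphic_on_subset[OF g(2)]) auto
      moreover have "\<forall>u\<in>ball (z i) \<epsilon> \<inter> ?S. ?q u = cmod (g u / h u)"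
      proof
        fix u assume u: "u \<in> ball (z i) \<epsilon> \<inter> ?S"
        have "z i \<notin> ?S"
          using i lattice_0 unfolding punctured_iff by (metis diff_self)
        then have ui: "u \<noteq> z i"
          using u by auto
        then have "u \<in> ball (z i) \<epsilon>1" "u \<in> ball (z i) \<epsilon>2 - {z i}"
          using u \<epsilon>(2,3) by blast+
        then show "?q u = cmod (g u / h u)"
          using ui by (simp add: h(5) g(3) norm_divide)
      qed
      moreover have "ball (z i) \<epsilon> - {z i} \<subseteq> ?S"
        using h(4) \<epsilon>(2) by blast
      ultimately show ?thesis
        using \<epsilon>(1) lattice_minus[OF l]
        by (intro bexI[of _ "- (p - z i)"] exI[of _ \<epsilon>] conjI exI[of _ "\<lambda>u. g u / h u"]) simp_all
    qed
  qed (rule that)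
qed

text \<open>The first conjunct gives the second its content: the right-hand side constrains m only
  where branches exist. The equivalence yields existence of the metric as well as its uniqueness up
  to a constant.\<close>

theorem proposition1p2:
  fixes n :: nat and \<alpha> :: "nat \<Rightarrow> real" and \<tau> :: complex and z :: "nat \<Rightarrow> complex"
  assumes "n \<ge> 2"
    and "\<And>i. i \<in> {1..n} \<Longrightarrow> \<alpha> i > -1"
    and "(\<Sum>i=1..n. \<alpha> i) = 0"
    and "Im \<tau> > 0"
    and "inj_on (\<lambda>i. torus_point \<tau> (z i)) {1..n}"
  shows "(\<forall>p \<in> punctured \<tau> n z. \<exists>U T. p \<in> U \<and> T_branch \<tau> n \<alpha> z U T) \<and>
    (\<forall>m. flat_cone_metric \<tau> n \<alpha> z m \<longleftrightarrow>
       (\<exists>c>0. \<forall>U T. T_branch \<tau> n \<alpha> z U T \<longrightarrow>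
          (\<forall>u\<in>U. \<forall>v w. m u v w = c * abs_sq_form (T u) v w)))"
proof (intro conjI ballI allI)
  note \<alpha> = assms(2,3) and \<tau> = assms(4) and inj = assms(5)
  let ?S = "punctured \<tau> n z"
  show "\<exists>U T. p \<in> U \<and> T_branch \<tau> n \<alpha> z U T" if "p \<in> ?S" for p
    using T_branch_exists[OF \<tau> that] by (metis centre_in_ball)
  fix m
  show "flat_cone_metric \<tau> n \<alpha> z m \<longleftrightarrow> (\<exists>c>0. \<forall>U T. T_branch \<tau> n \<alpha> z U T \<longrightarrow>
          (\<forall>u\<in>U. \<forall>v w. m u v w = c * abs_sq_form (T u) v w))"
    unfolding T_metric_iff[OF \<tau>]
  proof
    assume m: "flat_cone_metric \<tau> n \<alpha> z m"
    obtain c where c: "\<And>u. u \<in> ?S \<Longrightarrow> sqrt (m u 1 1) / T_abs \<tau> n \<alpha> z u = c"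
      using flat_cone_metric_ratio_constant[OF \<tau> \<alpha>(2) inj m] by metis
    \<comment> \<open>c is a ratio of lengths, hence the square in the metric; its sign is read off
      at a point of \<open>?S\<close>.\<close>
    have *: "c > 0 \<and> (\<forall>v w. m u v w = c\<^sup>2 * ((T_abs \<tau> n \<alpha> z u)\<^sup>2 * (v \<bullet> w)))" if u: "u \<in> ?S" for u
    proof -
      obtain r where r: "r > 0" "\<And>v w. m u v w = r * (v \<bullet> w)"
        using m u unfolding flat_cone_metric_def conformal_on_def by metis
      have "m u 1 1 = r"
        using r(2)[of 1 1] by simp
      moreover have T: "T_abs \<tau> n \<alpha> z u > 0"
        by (rule T_abs_pos[OF \<tau> u])
      ultimately have sqrt_r: "sqrt r = c * T_abs \<tau> n \<alpha> z u"
        using c[OF u] by (auto simp: divide_eq_eq)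
      have "0 < c * T_abs \<tau> n \<alpha> z u"
        unfolding sqrt_r[symmetric] using r(1) by simp
      then have "c > 0"
        using T by (simp add: zero_less_mult_iff)
      from sqrt_r have "r = c\<^sup>2 * (T_abs \<tau> n \<alpha> z u)\<^sup>2"
        using r(1) by (metis less_imp_le power_mult_distrib real_sqrt_pow2)
      with \<open>c > 0\<close> show ?thesis
        using r(2) by (simp add: mult.assoc)
    qed
    show "\<exists>c>0. \<forall>u\<in>?S. \<forall>v w. m u v w = c * ((T_abs \<tau> n \<alpha> z u)\<^sup>2 * (v \<bullet> w))"
    \<comment> \<open>Without a point of \<open>?S\<close> the sign of c is unknown, and the
      constant 1 serves.\<close>
    proof (cases "?S = {}")
      case True
      then show ?thesis
        by (intro exI[of _ 1]) auto
    next
      case False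
      then show ?thesis
        using * by (intro exI[of _ "c\<^sup>2"]) auto
    qed
  next
    assume "\<exists>c>0. \<forall>u\<in>?S. \<forall>v w. m u v w = c * ((T_abs \<tau> n \<alpha> z u)\<^sup>2 * (v \<bullet> w))"
    then obtain c where c: "c > 0"
      and m: "\<And>u v w. u \<in> ?S \<Longrightarrow> m u v w = c * ((T_abs \<tau> n \<alpha> z u)\<^sup>2 * (v \<bullet> w))"
      by blast
    have "lattice_invariant_on ?S \<tau> m"
      unfolding lattice_invariant_on_def
      by (intro ballI ext) (simp add: m punctured_add T_abs_periodic[OF \<tau> \<alpha>(2)])
    moreover have "conformal_on ?S m"
      unfolding conformal_on_def
    proof
      fix u assume u: "u \<in> ?S"
      show "\<exists>r>0. \<forall>v w. m u v w = r * (v \<bullet> w)"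
        using c T_abs_pos[OF \<tau> u, of \<alpha>] m[OF u]
        by (intro exI[of _ "c * (T_abs \<tau> n \<alpha> z u)\<^sup>2"]) (simp add: mult.assoc)
    qed
    ultimately show "flat_cone_metric \<tau> n \<alpha> z m"
      unfolding flat_cone_metric_def
      using T_metric_flat[OF \<tau> c m] T_metric_conical[OF \<tau> c inj m _ \<alpha>(1)] by blast
  qed
qed

end
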